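(* $[0,0,3,0]=5$. That is: let $n\ge 5$, let $r_1,r_2,r_3$ be three distinct red vertices and $g_1,g_2,g_3$ be three distinct green vertices in $\mathcal{Q}_n$. Then there exists a $3$-path covering of $\mathcal{Q}_n$ with paths $\gamma_1,\gamma_2,\gamma_3$ such that $\gamma_i$ connects $r_i$ to $g_i$ for $i=1,2,3$. The claim is not true if $n=3$ or $n=4$ (for each of these $n$ there are such vertices for which no such covering exists).
   Context: $\mathcal{Q}_n$ is the $n$-dimensional binary hypercube: its vertices are all binary sequences of length $n$, adjacent iff they differ in exactly one position. A vertex is even or odd according to the parity of its number of 1's; vertices of one parity are called red and those of the other parity green. A path covering of a graph is a set of vertex-disjoint paths that cover all vertices of the graph; a $k$-path covering is a path covering by exactly $k$ paths. A fault $\mathcal{F}$ in $\mathcal{Q}_n$ is a set of deleted vertices; its mass is $|\mathcal{F}|$ and its charge is $|r(\mathcal{F})-g(\mathcal{F})|$, where $r(\mathcal{F})$, $g(\mathcal{F})$ are the numbers of red and green vertices in $\mathcal{F}$. $\mathcal{Q}_n-\mathcal{F}$ is the subgraph induced by the non-deleted vertices. A pair of vertices (or a path, via its two endpoints) is neutral if the two vertices have opposite parity and charged if they have the same parity; a charged pair is red (green) if its elements are red (green). A set $\mathcal{E}$ of disjoint pairs of vertices is in balance with $\mathcal{F}$ if all vertices in the pairs lie in $\mathcal{Q}_n-\mathcal{F}$ and $r(\mathcal{F})-g(\mathcal{F})=g(\mathcal{E})-r(\mathcal{E})$, where $r(\mathcal{E})$, $g(\mathcal{E})$ are the numbers of red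 and green pairs in $\mathcal{E}$. For a fault $\mathcal{F}$ of mass $M$ and charge $C$ in $\mathcal{Q}_n$, one can freely prescribe ends for a path covering of $\mathcal{Q}_n-\mathcal{F}$ with $N$ neutral paths and $O$ charged paths if (i) there is at least one set $\mathcal{E}$ of disjoint pairs of vertices in balance with $\mathcal{F}$ containing exactly $N$ neutral and $O$ charged pairs, and (ii) for every such $\mathcal{E}$ there is a path covering of $\mathcal{Q}_n-\mathcal{F}$ whose set of pairs of end vertices is $\mathcal{E}$. For nonnegative integers $M,C,N,O$, $\mathcal{A}_{M,C,N,O}$ is the set of nonnegative integers $m$ such that $m\ge\log_2[M+C+2N+2O]$ and for every $n\ge m$ and every fault $\mathcal{F}$ of mass $M$ and charge $C$ in $\mathcal{Q}_n$ one can freely prescribe ends for a path covering of $\mathcal{Q}_n-\mathcal{F}$ with $N$ neutral and $O$ charged paths. $[M,C,N,O]$ is the smallest element of $\mathcal{A}_{M,C,N,O}$ if this set is nonempty. *)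

theory Defs
  imports Complex_Main "Graph_Theory.Graph_Theory"
begin

type_synonym vertex = "bool list"

definition hypercube :: "nat \<Rightarrow> (vertex, vertex \<times> vertex) pre_digraph" where
  "hypercube n = with_proj
     \<lparr> pverts = {v. length v = n},
       parcs = {(u, v). length u = n \<and> length v = n \<and> card {i. i < n \<and> u ! i \<noteq> v ! i} = 1} \<rparr>"

text \<open>An undirected graph is a symmetric, loop-free digraph; the hypercube is one.\<close>

lemma graph_hypercube: "graph (hypercube n)"
proof -
  have fin: "finite {v :: bool list. length v = n}"
    using finite_lists_length_eq[of "UNIV :: bool set" n] by simp
  have sub: "{(u, v). length u = n \<and> length v = n \<and> card {i. i < n \<and> u ! i \<noteq> v ! i} = 1}
      \<subseteq> {v :: bool list. length v = n} \<times> {v. length v = n}" by auto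
  have swap: "{i. i < n \<and> u ! i \<noteq> v ! i} = {i. i < n \<and> v ! i \<noteq> u ! i}" for u v :: "bool list"
    by auto
  have "pair_graph
     \<lparr> pverts = {v :: vertex. length v = n},
       parcs = {(u, v). length u = n \<and> length v = n \<and> card {i. i < n \<and> u ! i \<noteq> v ! i} = 1} \<rparr>"
    (is "pair_graph ?G")
  proof unfold_locales
    show "finite (pverts ?G)" unfolding pair_pre_digraph.select_convs by (rule fin)
    show "finite (parcs ?G)" unfolding pair_pre_digraph.select_convs
      by (rule finite_subset[OF sub finite_cartesian_product[OF fin fin]])
    show "symmetric (with_proj ?G)"
      unfolding symmetric_def with_proj_simps
    proof (rule symI)
      fix u v assume "(u, v) \<in> parcs ?G"
      then show "(v, u) \<in> parcs ?G" unfolding pair_pre_digraph.select_convs mem_Collect_eq case_prod_conv swap[of v u] by blast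
    qed
  next
    fix e assume "e \<in> parcs ?G"
    moreover obtain u v where uv: "e = (u, v)" by (cases e)
    ultimately have e: "length u = n \<and> length v = n \<and> card {i. i < n \<and> u ! i \<noteq> v ! i} = 1"
      unfolding pair_pre_digraph.select_convs mem_Collect_eq case_prod_conv by (simp only: prod.case)
    show "fst e \<in> pverts ?G" "snd e \<in> pverts ?G" using uv e by simp_all
    show "fst e \<noteq> snd e" using uv e by auto
  qed
  then show ?thesis
    unfolding hypercube_def by (rule pair_graph.pair_graphD_graph)
qed

text \<open>Which parity is called red is immaterial (all notions below are symmetric in the two
  colours); here red means even.\<close>

definition red :: "vertex \<Rightarrow> bool" where
  "red v \<longleftrightarrow> even (count_list v True)"

abbreviation green :: "vertex \<Rightarrow> bool" where
  "green v \<equiv> \<not> red v"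

subsection \<open>Path coverings\<close>

text \<open>A path is given by its list of vertices (\<^const>\<open>vpath\<close>). A path and its reversal share their
  vertices, so disjointness excludes listing both orientations of one path.\<close>

definition path_covering :: "('a, 'b) pre_digraph \<Rightarrow> 'a list set \<Rightarrow> bool" where
  "path_covering G P \<longleftrightarrow>
     (\<forall>p\<in>P. vpath p G) \<and>
     (\<forall>p\<in>P. \<forall>q\<in>P. p \<noteq> q \<longrightarrow> set p \<inter> set q = {}) \<and>
     (\<Union>p\<in>P. set p) = verts G"

definition k_path_covering :: "nat \<Rightarrow> ('a, 'b) pre_digraph \<Rightarrow> 'a list set \<Rightarrow> bool" where
  "k_path_covering k G P \<longleftrightarrow> path_covering G P \<and> finite P \<and> card P = k"

definition ends :: "'a list \<Rightarrow> 'a set" where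
  "ends p = {hd p, last p}"

definition connects :: "'a list \<Rightarrow> 'a \<Rightarrow> 'a \<Rightarrow> bool" where
  "connects p u v \<longleftrightarrow> hd p = u \<and> last p = v"

subsection \<open>Faults\<close>

definition fault :: "nat \<Rightarrow> vertex set \<Rightarrow> bool" where
  "fault n F \<longleftrightarrow> F \<subseteq> verts (hypercube n)"

definition mass :: "vertex set \<Rightarrow> nat" where
  "mass F = card F"

definition red_excess :: "vertex set \<Rightarrow> int" where
  "red_excess F = int (card {v \<in> F. red v}) - int (card {v \<in> F. green v})"

definition charge :: "vertex set \<Rightarrow> nat" where
  "charge F = nat \<bar>red_excess F\<bar>"

definition faulty_hypercube :: "nat \<Rightarrow> vertex set \<Rightarrow> (vertex, vertex \<times> vertex) pre_digraph" where
  "faulty_hypercube n F = hypercube n \<restriction> (verts (hypercube n) - F)"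

subsection \<open>Pairs of vertices\<close>

text \<open>Pairs are unordered pairs of distinct vertices, i.e. two-element sets.\<close>

definition neutral_pair :: "vertex set \<Rightarrow> bool" where
  "neutral_pair e \<longleftrightarrow> (\<exists>u v. e = {u, v} \<and> u \<noteq> v \<and> red u \<noteq> red v)"

definition charged_pair :: "vertex set \<Rightarrow> bool" where
  "charged_pair e \<longleftrightarrow> (\<exists>u v. e = {u, v} \<and> u \<noteq> v \<and> red u = red v)"

definition red_pair :: "vertex set \<Rightarrow> bool" where
  "red_pair e \<longleftrightarrow> charged_pair e \<and> (\<forall>v\<in>e. red v)"

definition green_pair :: "vertex set \<Rightarrow> bool" where
  "green_pair e \<longleftrightarrow> charged_pair e \<and> (\<forall>v\<in>e. green v)"

definition disjoint_pairs :: "vertex set set \<Rightarrow> bool" where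
  "disjoint_pairs E \<longleftrightarrow>
     (\<forall>e\<in>E. card e = 2) \<and> (\<forall>e\<in>E. \<forall>e'\<in>E. e \<noteq> e' \<longrightarrow> e \<inter> e' = {})"

definition in_balance :: "nat \<Rightarrow> vertex set \<Rightarrow> vertex set set \<Rightarrow> bool" where
  "in_balance n F E \<longleftrightarrow>
     disjoint_pairs E \<and>
     \<Union>E \<subseteq> verts (faulty_hypercube n F) \<and>
     red_excess F = int (card {e \<in> E. green_pair e}) - int (card {e \<in> E. red_pair e})"

text \<open>Such a set of pairs is automatically finite, since the hypercube is.\<close>

definition prescribable :: "nat \<Rightarrow> vertex set \<Rightarrow> nat \<Rightarrow> nat \<Rightarrow> vertex set set \<Rightarrow> bool" where
  "prescribable n F N O' E \<longleftrightarrow>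
     in_balance n F E \<and>
     card {e \<in> E. neutral_pair e} = N \<and> card {e \<in> E. charged_pair e} = O'"

definition freely_prescribe_ends :: "nat \<Rightarrow> vertex set \<Rightarrow> nat \<Rightarrow> nat \<Rightarrow> bool" where
  "freely_prescribe_ends n F N O' \<longleftrightarrow>
     (\<exists>E. prescribable n F N O' E) \<and>
     (\<forall>E. prescribable n F N O' E \<longrightarrow>
        (\<exists>P. path_covering (faulty_hypercube n F) P \<and> ends ` P = E))"

subsection \<open>The numbers $[M,C,N,O]$\<close>

text \<open>If \<open>M + C + 2 * N + 2 * O' = 0\<close>, the logarithmic bound is void; this agrees with the
  convention \<open>log 2 0 = 0\<close>.\<close>

definition A_set :: "nat \<Rightarrow> nat \<Rightarrow> nat \<Rightarrow> nat \<Rightarrow> nat set" where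
  "A_set M C N O' =
     {m. real m \<ge> log 2 (real (M + C + 2 * N + 2 * O')) \<and>
         (\<forall>n\<ge>m. \<forall>F. fault n F \<and> mass F = M \<and> charge F = C \<longrightarrow> freely_prescribe_ends n F N O')}"

text \<open>Meaningful only if \<^const>\<open>A_set\<close> is nonempty.\<close>

definition bracket :: "nat \<Rightarrow> nat \<Rightarrow> nat \<Rightarrow> nat \<Rightarrow> nat" where
  "bracket M C N O' = (LEAST m. m \<in> A_set M C N O')"

end

theory Submission
  imports Defs "HOL-Library.Multiset"
begin

text \<open>
  A coordinate \<open>d\<close> cuts \<open>Q\<^bsub>n+1\<^esub>\<close> into two copies of \<open>Q\<^sub>n\<close>, the faces, joined by a perfect matching
  between equal vertices of \<open>Q\<^sub>n\<close>. A path covering of the whole cube is glued from path coverings of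
  the faces: a path that has to cross ends in one face at a vertex \<open>w\<close> of suitable colour and continues
  in the other face at the same \<open>w\<close>. Nothing below depends on which colour is which, so the pairs are
  treated as ordered pairs \<open>a\<^sub>i, b\<^sub>i\<close> of opposite colours.

  In this way one obtains, by induction on the dimension, Hamiltonian paths between vertices of
  opposite colours (\<open>ham_cube\<close>), coverings by two neutral paths for \<open>n \<ge> 2\<close> (\<open>link2_cube\<close>) and
  Hamiltonian paths of \<open>Q\<^sub>n\<close> minus one vertex (\<open>ham_without_cube\<close>). From these follow, for \<open>n \<ge> 4\<close>,
  coverings by one red and one green path (\<open>link2_charged\<close>).

  Three neutral paths in \<open>Q\<^bsub>n+1\<^esub>\<close>, \<open>n \<ge> 4\<close>, never require three prescribed neutral paths in a face, so
  that no induction on the three-path statement is involved. With respect to a coordinate each pair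
  either lies in one face or crosses.
  If two pairs lie in different faces, each face has to carry at most two paths.
  If two pairs lie in the same face and the third crosses, cover that face by the two paths only; the
  vertex \<open>a\<^sub>3\<close> that lies on one of them is bypassed through the other face, which then carries the
  bypass and the rest of the third path: two charged paths of opposite colours.
  If one pair lies in a face and two cross, consider the ends of the latter in that face. If they have
  the same colour, the face is covered by the path of the first pair and two paths that start at these
  ends and whose other ends are free (\<open>link3_free_ends\<close>). If they have opposite colours, they are
  joined by a path, which is cut at its first or last edge; in the one exceptional case another
  coordinate puts two pairs into different faces.
  If every coordinate either makes all three pairs cross or does not separate \<open>a\<^sub>1, a\<^sub>2, a\<^sub>3\<close>, which may
  be taken to have the same colour, two coordinates can be
  chosen for which the six ends are spread over the four quarters in one fixed pattern, and two
  neutral paths per quarter, together with one quarter cut into three paths, give the covering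
  (\<open>link3_quadrants\<close>).

  In dimensions 3 and 4 the pairs of antipodes of a three-dimensional cube cannot be joined. That
  cube is \<open>K\<^bsub>4,4\<^esub>\<close> minus the perfect matching of antipodes, so a vertex outside the three pairs is
  adjacent within it to three ends belonging to three different paths, of which it can use at most
  one. For \<open>n = 3\<close> this is already absurd; for \<open>n = 4\<close> it forces the edges that leave the cube, until
  some vertex of the opposite face lacks two neighbours on a common path (\<open>no_covering_3\<close>,
  \<open>no_covering_4\<close>).
\<close>

section \<open>Splitting a hypercube along a coordinate\<close>

definition cube :: "nat \<Rightarrow> vertex set" where
  "cube n = {v. length v = n}"

definition adj :: "vertex \<Rightarrow> vertex \<Rightarrow> bool" where
  "adj u v \<longleftrightarrow> (\<exists>p b q. u = p @ b # q \<and> v = p @ (\<not> b) # q)"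

lemma adj_sym: "adj u v \<Longrightarrow> adj v u"
proof -
  assume "adj u v"
  then obtain p b q where "v = p @ (\<not> b) # q" "u = p @ (\<not> \<not> b) # q"
    unfolding adj_def by auto
  then show "adj v u" unfolding adj_def by blast
qed

lemma adj_red:
  assumes "adj u v" shows "red v \<longleftrightarrow> \<not> red u"
proof -
  obtain p b q where "u = p @ b # q" "v = p @ (\<not> b) # q"
    using assms unfolding adj_def by blast
  then show ?thesis by (cases b) (auto simp: red_def)
qed

lemma adj_length: "adj u v \<Longrightarrow> length v = length u"
  by (auto simp: adj_def)

lemma card_differ_eq_1_iff_adj:
  assumes "length u = n" "length v = n"
  shows "card {i. i < n \<and> u ! i \<noteq> v ! i} = 1 \<longleftrightarrow> adj u v"
proof
  assume "card {i. i < n \<and> u ! i \<noteq> v ! i} = 1"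
  then obtain i where i: "{i. i < n \<and> u ! i \<noteq> v ! i} = {i}"
    by (rule card_1_singletonE)
  then have "i < n" "u ! i \<noteq> v ! i" by auto
  have same: "u ! j = v ! j" if "j < n" "j \<noteq> i" for j
    using i that by auto
  have "take i u = take i v" "drop (Suc i) u = drop (Suc i) v"
    using assms same \<open>i < n\<close> by (auto intro!: nth_equalityI)
  then have "u = take i u @ u ! i # drop (Suc i) u"
    "v = take i u @ (\<not> u ! i) # drop (Suc i) u"
    using assms \<open>i < n\<close> \<open>u ! i \<noteq> v ! i\<close> id_take_nth_drop[of i u] id_take_nth_drop[of i v] by auto
  then show "adj u v" unfolding adj_def by blast
next
  assume "adj u v"
  then obtain p b q where u: "u = p @ b # q" and v: "v = p @ (\<not> b) # q"
    unfolding adj_def by blast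
  have "{i. i < n \<and> u ! i \<noteq> v ! i} = {length p}"
    using assms by (auto simp: u v nth_append nth_Cons')
  then show "card {i. i < n \<and> u ! i \<noteq> v ! i} = 1" by simp
qed

text \<open>The embedding of \<open>Q\<^sub>n\<close> onto the face of \<open>Q\<^bsub>n+1\<^esub>\<close> on which coordinate \<open>d\<close> is \<open>b\<close>. Positions of the
  inserted bit range over \<open>0, \<dots>, n\<close>, whence the condition \<open>d \<le> n\<close> throughout.\<close>

definition ins :: "nat \<Rightarrow> bool \<Rightarrow> vertex \<Rightarrow> vertex" where
  "ins d b v = take d v @ b # drop d v"

lemma ins_cube [simp]: "v \<in> cube n \<Longrightarrow> ins d b v \<in> cube (Suc n)"
  by (simp add: cube_def ins_def)

lemma red_ins [simp]: "red (ins d b v) \<longleftrightarrow> red v \<noteq> b"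
proof -
  have "count_list v True = count_list (take d v) True + count_list (drop d v) True"
    by (metis append_take_drop_id count_list_append)
  then show ?thesis by (cases b) (auto simp: ins_def red_def)
qed

lemma ins_nth [simp]: "v \<in> cube n \<Longrightarrow> d \<le> n \<Longrightarrow> ins d b v ! d = b"
  by (simp add: cube_def ins_def nth_append)

lemma ins_eq_iff [simp]:
  assumes "u \<in> cube n" "v \<in> cube n" "d \<le> n"
  shows "ins d b u = ins d c v \<longleftrightarrow> b = c \<and> u = v"
proof -
  have "ins d b u = ins d c v \<longleftrightarrow> take d u = take d v \<and> b = c \<and> drop d u = drop d v"
    using assms by (simp add: ins_def cube_def)
  also have "\<dots> \<longleftrightarrow> b = c \<and> u = v" by (metis append_take_drop_id)
  finally show ?thesis .
qed

lemma obtain_ins: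
  assumes "v \<in> cube (Suc n)" "d \<le> n" "v ! d = s"
  obtains u where "u \<in> cube n" "v = ins d s u"
proof
  show "take d v @ drop (Suc d) v \<in> cube n" using assms by (auto simp: cube_def)
  show "v = ins d s (take d v @ drop (Suc d) v)"
    using assms id_take_nth_drop[of d v] by (auto simp: cube_def ins_def)
qed

lemma differing_coordinate:
  assumes "u \<in> cube (Suc n)" "v \<in> cube (Suc n)" "u \<noteq> v"
  obtains d where "d \<le> n" "u ! d \<noteq> v ! d"
proof -
  have "length u = Suc n" "length v = Suc n" using assms by (auto simp: cube_def)
  then obtain d where "d < Suc n" "u ! d \<noteq> v ! d"
    using \<open>u \<noteq> v\<close> nth_equalityI[of u v] by auto
  then show ?thesis using that by (simp add: less_Suc_eq_le)
qed

text \<open>Coordinate \<open>e\<close> of a face perpendicular to \<open>d\<close> is coordinate \<open>skip d e\<close> of the whole cube.\<close>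

definition skip :: "nat \<Rightarrow> nat \<Rightarrow> nat" where
  "skip d e = (if e < d then e else Suc e)"

lemma ins_nth_skip [simp]: "v \<in> cube n \<Longrightarrow> d \<le> n \<Longrightarrow> e < n \<Longrightarrow> ins d b v ! skip d e = v ! e"
  by (auto simp: cube_def ins_def skip_def nth_append Suc_diff_le)

lemma skip_le: "e < n \<Longrightarrow> skip d e \<le> n"
  by (simp add: skip_def)

lemma obtain_skip:
  assumes "d \<le> Suc n" "e \<le> Suc n" "d \<noteq> e"
  obtains e' where "e' \<le> n" "e = skip d e'"
proof
  let ?e' = "if e < d then e else e - 1"
  show "?e' \<le> n" "e = skip d ?e'" using assms by (auto simp: skip_def)
qed

lemma ins_pair_exists:
  assumes "{a, b} \<subseteq> cube (Suc n)" "d \<le> n" "a ! d = s" "b ! d = t"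
  shows "\<exists>x y. x \<in> cube n \<and> y \<in> cube n \<and> a = ins d s x \<and> b = ins d t y"
proof -
  have "a \<in> cube (Suc n)" "b \<in> cube (Suc n)" using assms(1) by auto
  obtain x where "x \<in> cube n" "a = ins d s x"
    using obtain_ins[OF \<open>a \<in> cube (Suc n)\<close> assms(2,3)] .
  moreover obtain y where "y \<in> cube n" "b = ins d t y"
    using obtain_ins[OF \<open>b \<in> cube (Suc n)\<close> assms(2,4)] .
  ultimately show ?thesis by blast
qed

lemma obtain_ins_ins:
  assumes "v \<in> cube (Suc (Suc n))" "d \<le> Suc n" "e \<le> n" "v ! d = s" "v ! skip d e = t"
  obtains u where "u \<in> cube n" "v = ins d s (ins e t u)"
proof -
  obtain w where w: "w \<in> cube (Suc n)" "v = ins d s w"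
    using obtain_ins[OF assms(1,2,4)] .
  then have "w ! e = t" using assms by simp
  then obtain u where "u \<in> cube n" "w = ins e t u"
    using obtain_ins[OF w(1) assms(3)] by blast
  then show ?thesis using that w by blast
qed

lemma adj_ins_across:
  assumes "s \<noteq> t" shows "adj (ins d s v) (ins d t v)"
proof -
  have "t = (\<not> s)" using assms by auto
  then show ?thesis unfolding adj_def ins_def by blast
qed

lemma adj_ins:
  assumes "adj u v" shows "adj (ins d b u) (ins d b v)"
proof -
  obtain p c q where u: "u = p @ c # q" and v: "v = p @ (\<not> c) # q"
    using assms unfolding adj_def by blast
  show ?thesis
  proof (cases "d \<le> length p")
    case True
    then have "ins d b u = (take d p @ b # drop d p) @ c # q"
      "ins d b v = (take d p @ b # drop d p) @ (\<not> c) # q" by (simp_all add: ins_def u v)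
    then show ?thesis unfolding adj_def by blast
  next
    case False
    then obtain k where "d = Suc (length p + k)"
      by (metis add_Suc_right less_imp_Suc_add not_le)
    then have "ins d b u = p @ c # (take k q @ b # drop k q)"
      "ins d b v = p @ (\<not> c) # (take k q @ b # drop k q)"
      by (simp_all add: ins_def u v)
    then show ?thesis unfolding adj_def by blast
  qed
qed

lemma finite_cube [simp]: "finite (cube n)"
  using finite_lists_length_eq[of "UNIV :: bool set" n] by (simp add: cube_def)

lemma card_cube [simp]: "card (cube n) = 2 ^ n"
  using card_lists_length_eq[of "UNIV :: bool set" n] by (simp add: cube_def)

lemma mset_cube_Suc:
  assumes "d \<le> n" "s \<noteq> t"
  shows "mset_set (cube (Suc n)) =
    image_mset (ins d s) (mset_set (cube n)) + image_mset (ins d t) (mset_set (cube n))"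
proof -
  have inj: "inj_on (ins d b) (cube n)" for b
    using assms by (auto simp: inj_on_def)
  have "cube (Suc n) = ins d s ` cube n \<union> ins d t ` cube n"
  proof
    show "cube (Suc n) \<subseteq> ins d s ` cube n \<union> ins d t ` cube n"
    proof
      fix v assume "v \<in> cube (Suc n)"
      then obtain u where "u \<in> cube n" "v = ins d (v ! d) u"
        using \<open>d \<le> n\<close> by (rule obtain_ins) simp
      then show "v \<in> ins d s ` cube n \<union> ins d t ` cube n"
        using \<open>s \<noteq> t\<close> by (cases "v ! d = s") auto
    qed
  qed auto
  moreover have "ins d s ` cube n \<inter> ins d t ` cube n = {}" using assms by auto
  ultimately show ?thesis
    by (simp add: mset_set_Union image_mset_mset_set[OF inj])
qed

text \<open>Disjointness and covering together say that the multiset of all vertices on the paths is the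
  set of vertices. In this form gluing coverings of two faces is addition of multisets.\<close>

lemma mset_cube_Suc_glue:
  assumes "d \<le> n" "s \<noteq> t" "A = mset_set (cube n)" "B = mset_set (cube n)"
  shows "image_mset (ins d s) A + image_mset (ins d t) B = mset_set (cube (Suc n))"
  using assms mset_cube_Suc[of d n s t] by simp

lemma mset_eq_mset_cube:
  assumes "distinct xs" "set xs \<subseteq> cube n" "length xs = 2 ^ n"
  shows "mset xs = mset_set (cube n)"
proof -
  have "set xs = cube n"
    using assms by (intro card_subset_eq) (auto simp: distinct_card)
  then show ?thesis using mset_set_set[OF assms(1)] by simp
qed

lemma red_Cons [simp]: "red (b # v) \<longleftrightarrow> red v \<noteq> b"
  using red_ins[of 0 b v] by (simp add: ins_def del: red_ins)

text \<open>There are \<open>2 ^ (n - 1) \<ge> n\<close> vertices of each colour, so fewer than \<open>n\<close> of them can be avoided.\<close>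

lemma fresh_vertex:
  assumes "length xs < n"
  obtains w where "w \<in> cube n" "red w \<longleftrightarrow> c" "w \<notin> set xs"
proof -
  obtain m where n: "n = Suc m" using assms by (cases n) auto
  let ?f = "\<lambda>v. (red v \<noteq> c) # v"
  have "length xs < 2 ^ m" using assms n less_exp[of m] by linarith
  moreover have "card (?f ` cube m) = 2 ^ m"
    by (subst card_image) (auto simp: inj_on_def)
  ultimately have "\<not> ?f ` cube m \<subseteq> set xs"
    using card_length[of xs] card_mono[of "set xs" "?f ` cube m"] by auto
  then obtain v where "v \<in> cube m" "?f v \<notin> set xs" by blast
  then show ?thesis using that[of "?f v"] n by (auto simp: cube_def)
qed

definition joins :: "vertex \<Rightarrow> vertex list \<Rightarrow> vertex \<Rightarrow> bool" where
  "joins a p b \<longleftrightarrow> p \<noteq> [] \<and> hd p = a \<and> last p = b \<and> successively adj p"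

lemma joins_single [simp]: "joins a [c] b \<longleftrightarrow> a = c \<and> b = c"
  by (auto simp: joins_def)

lemma joins_Cons: "adj a c \<Longrightarrow> joins c q b \<Longrightarrow> joins a (a # q) b"
  by (cases q) (auto simp: joins_def)

lemma joins_append: "joins a p b \<Longrightarrow> adj b c \<Longrightarrow> joins c q d \<Longrightarrow> joins a (p @ q) d"
  by (auto simp: joins_def successively_append_iff)

lemma joins_rev: "joins a p b \<Longrightarrow> joins b (rev p) a"
  by (auto simp: joins_def hd_rev last_rev successively_rev intro: successively_mono adj_sym)

lemma joins_ins: "joins a p b \<Longrightarrow> joins (ins d s a) (map (ins d s) p) (ins d s b)"
  by (auto simp: joins_def hd_map last_map successively_map intro: successively_mono adj_ins)

lemma joins_ends: "joins a p b \<Longrightarrow> a \<in> set p \<and> b \<in> set p"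
  by (auto simp: joins_def)

lemma joins_split:
  assumes "joins a (p @ q) b" "p \<noteq> []" "q \<noteq> []"
  obtains u v where "joins a p u" "adj u v" "joins v q b"
  using assms that[of "last p" "hd q"] by (auto simp: joins_def successively_append_iff)

lemma adj_Nil [simp]: "\<not> adj [] v"
  by (simp add: adj_def)

lemma adj_Cons_Cons [simp]:
  "adj (b # u) (c # v) \<longleftrightarrow> (if b = c then adj u v else u = v)"
proof
  assume "adj (b # u) (c # v)"
  then obtain p x q where *: "b # u = p @ x # q" "c # v = p @ (\<not> x) # q"
    unfolding adj_def by blast
  then show "if b = c then adj u v else u = v"
    by (cases p) (auto simp: adj_def)
next
  assume "if b = c then adj u v else u = v"
  then show "adj (b # u) (c # v)"
    using adj_ins[of u v 0 b] adj_ins_across[of b c 0 u] by (auto simp: ins_def split: if_splits)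
qed

lemma joins_across:
  assumes "joins a p w" "joins w q b" "s \<noteq> t"
  shows "joins (ins d s a) (map (ins d s) p @ map (ins d t) q) (ins d t b)"
  using assms by (blast intro: joins_append joins_ins adj_ins_across)

lemma joins_first_edge:
  assumes "joins a p b" "a \<noteq> b"
  obtains v q where "p = a # q" "adj a v" "joins v q b"
proof -
  obtain q where "p = a # q"
    using assms by (cases p) (auto simp: joins_def)
  then have q: "p = a # q" "q \<noteq> []"
    using assms by (auto simp: joins_def)
  then have "joins a ([a] @ q) b" using assms by simp
  then obtain u v where "joins a [a] u" "adj u v" "joins v q b"
    using q by (elim joins_split) auto
  then show ?thesis using that q by simp
qed

text \<open>A neutral pair excludes only one vertex of the wanted colour.\<close>

lemma fresh_vertex_avoiding_pairs:
  assumes "3 \<le> n" "red x \<noteq> red y" "red x' \<noteq> red y'"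
  obtains w where "w \<in> cube n" "red w \<longleftrightarrow> c" "w \<notin> {x, y, x', y'}"
proof -
  let ?xs = "[if red x = c then x else y, if red x' = c then x' else y']"
  obtain w where "w \<in> cube n" "red w \<longleftrightarrow> c" "w \<notin> set ?xs"
    using fresh_vertex[of ?xs n c] assms(1) by auto
  then show ?thesis using that assms by (auto split: if_splits)
qed

lemma distinct_if_mset_set:
  assumes "mset xs = mset_set A" "finite A" shows "distinct xs"
  using assms by (simp add: distinct_count_atmost_1 set_mset_mset[symmetric] del: set_mset_mset)

section \<open>Hamiltonian paths and two neutral paths\<close>

definition ham :: "nat \<Rightarrow> vertex \<Rightarrow> vertex \<Rightarrow> bool" where
  "ham n a b \<longleftrightarrow> (\<exists>p. joins a p b \<and> mset p = mset_set (cube n))"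

definition ham_without :: "nat \<Rightarrow> vertex \<Rightarrow> vertex \<Rightarrow> vertex \<Rightarrow> bool" where
  "ham_without n c a b \<longleftrightarrow> (\<exists>p. joins a p b \<and> add_mset c (mset p) = mset_set (cube n))"

definition link2 :: "nat \<Rightarrow> vertex \<Rightarrow> vertex \<Rightarrow> vertex \<Rightarrow> vertex \<Rightarrow> bool" where
  "link2 n a1 b1 a2 b2 \<longleftrightarrow>
    (\<exists>p q. joins a1 p b1 \<and> joins a2 q b2 \<and> mset p + mset q = mset_set (cube n))"

lemma link2_swap: "link2 n a2 b2 a1 b1 \<Longrightarrow> link2 n a1 b1 a2 b2"
  unfolding link2_def by (metis add.commute)

lemma link2_rev: "link2 n b1 a1 a2 b2 \<Longrightarrow> link2 n a1 b1 a2 b2"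
  unfolding link2_def by (metis joins_rev mset_rev)

lemma ham_cube:
  assumes "1 \<le> n" "a \<in> cube n" "b \<in> cube n" "red a \<noteq> red b"
  shows "ham n a b"
  using assms
proof (induction n arbitrary: a b rule: nat_induct_at_least)
  case base
  then obtain x y where "a = [x]" "b = [y]"
    by (auto simp: cube_def length_Suc_conv)
  with base have "joins a [a, b] b" "distinct [a, b]"
    by (auto simp: joins_def)
  with base show ?case
    unfolding ham_def by (intro exI[of _ "[a, b]"] conjI mset_eq_mset_cube) auto
next
  case (Suc n)
  then obtain d where d: "d \<le> n" "a ! d \<noteq> b ! d"
    by (metis differing_coordinate)
  define s t where "s = a ! d" and "t = b ! d"
  then have "s \<noteq> t" using d by simp
  obtain x where x: "x \<in> cube n" "a = ins d s x"
    using obtain_ins[OF Suc.prems(1) d(1)] s_def by blast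
  obtain y where y: "y \<in> cube n" "b = ins d t y"
    using obtain_ins[OF Suc.prems(2) d(1)] t_def by blast
  obtain w where w: "w \<in> cube n" "red w \<longleftrightarrow> \<not> red x"
    using fresh_vertex[of "[]" n "\<not> red x"] Suc.hyps by auto
  have "red w \<noteq> red y" using w x y Suc.prems(3) \<open>s \<noteq> t\<close> by auto
  obtain p q where p: "joins x p w" "mset p = mset_set (cube n)"
    and q: "joins w q y" "mset q = mset_set (cube n)"
    using Suc.IH[of x w] Suc.IH[of w y] w x y \<open>red w \<noteq> red y\<close> unfolding ham_def by auto
  show ?case
    unfolding ham_def x y
    using joins_across[OF p(1) q(1) \<open>s \<noteq> t\<close>] mset_cube_Suc_glue[OF d(1) \<open>s \<noteq> t\<close> p(2) q(2)]
    by (intro exI conjI) auto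
qed

lemma ham_obtain:
  assumes "1 \<le> n" "a \<in> cube n" "b \<in> cube n" "red a \<noteq> red b"
  obtains p where "joins a p b" "mset p = mset_set (cube n)"
  using ham_cube[OF assms] unfolding ham_def by blast

definition neutral2 :: "nat \<Rightarrow> vertex \<Rightarrow> vertex \<Rightarrow> vertex \<Rightarrow> vertex \<Rightarrow> bool" where
  "neutral2 n a1 b1 a2 b2 \<longleftrightarrow> {a1, b1, a2, b2} \<subseteq> cube n \<and> red a1 \<noteq> red b1 \<and> red a2 \<noteq> red b2 \<and>
    {a1, b1} \<inter> {a2, b2} = {}"

lemma neutral2_swap: "neutral2 n a2 b2 a1 b1 \<longleftrightarrow> neutral2 n a1 b1 a2 b2"
  by (auto simp: neutral2_def)

lemma link2_opposite_sides:
  assumes "1 \<le> n" "d \<le> n" "s \<noteq> t" "{x1, y1, x2, y2} \<subseteq> cube n"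
    and "red x1 \<noteq> red y1" "red x2 \<noteq> red y2"
  shows "link2 (Suc n) (ins d s x1) (ins d s y1) (ins d t x2) (ins d t y2)"
proof -
  obtain p where p: "joins x1 p y1" "mset p = mset_set (cube n)"
    using ham_obtain[of n x1 y1] assms by auto
  obtain q where q: "joins x2 q y2" "mset q = mset_set (cube n)"
    using ham_obtain[of n x2 y2] assms by auto
  show ?thesis
    unfolding link2_def
    using joins_ins[OF p(1)] joins_ins[OF q(1)] mset_cube_Suc_glue[OF assms(2,3) p(2) q(2)]
    by (intro exI conjI) auto
qed

text \<open>One face is covered by both paths; some edge of the first path is then replaced by a Hamiltonian path
  of the opposite face between the neighbours of its two vertices.\<close>

lemma link2_same_side:
  assumes "1 \<le> n" "d \<le> n" "s \<noteq> t" "{x1, y1, x2, y2} \<subseteq> cube n"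
    and "x1 \<noteq> y1" and IH: "link2 n x1 y1 x2 y2"
  shows "link2 (Suc n) (ins d s x1) (ins d s y1) (ins d s x2) (ins d s y2)"
proof -
  obtain p q where p: "joins x1 p y1" and q: "joins x2 q y2"
    and pq: "mset p + mset q = mset_set (cube n)"
    using IH unfolding link2_def by blast
  obtain u p' where p': "p = x1 # p'" "adj x1 u" "joins u p' y1"
    using \<open>x1 \<noteq> y1\<close> by (rule joins_first_edge[OF p])
  have "u \<in> cube n" using adj_length[OF p'(2)] assms(4) by (simp add: cube_def)
  then obtain r where r: "joins x1 r u" "mset r = mset_set (cube n)"
    using ham_obtain[of n x1 u] adj_red[OF p'(2)] assms by auto
  have "joins (ins d s x1) ([ins d s x1] @ map (ins d t) r @ map (ins d s) p') (ins d s y1)"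
    using joins_Cons[OF adj_ins_across[OF \<open>s \<noteq> t\<close>]
        joins_append[OF joins_ins[OF r(1)] adj_ins_across[of t s] joins_ins[OF p'(3)]]] \<open>s \<noteq> t\<close>
    by simp
  then show ?thesis
    unfolding link2_def
    using joins_ins[OF q(1)] mset_cube_Suc_glue[OF assms(2,3) pq r(2)]
    by (intro exI conjI) (auto simp: p' ac_simps)
qed

lemma link2_one_crossing:
  assumes "2 \<le> n" "d \<le> n" "s \<noteq> t" "{x1, y1, x2, y2} \<subseteq> cube n"
    and "red x1 \<noteq> red y1" "red x2 = red y2" "x2 \<notin> {x1, y1}"
    and IH: "\<And>x1 y1 x2 y2. neutral2 n x1 y1 x2 y2 \<Longrightarrow> link2 n x1 y1 x2 y2"
  shows "link2 (Suc n) (ins d s x1) (ins d s y1) (ins d s x2) (ins d t y2)"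
proof -
  \<comment> \<open>Only one of the ends of the first pair has the colour of the vertex to be chosen.\<close>
  obtain w where w: "w \<in> cube n" "red w \<noteq> red x2" "w \<notin> {x1, y1}"
  proof -
    obtain w where "w \<in> cube n" "red w \<longleftrightarrow> \<not> red x2"
      "w \<notin> set [if red x1 = red x2 then y1 else x1]"
      using fresh_vertex[of "[if red x1 = red x2 then y1 else x1]" n "\<not> red x2"] assms(1) by auto
    then show thesis using that assms by (auto split: if_splits)
  qed
  have "neutral2 n x1 y1 x2 w"
    using assms w by (auto simp: neutral2_def)
  then obtain p q where p: "joins x1 p y1" and q: "joins x2 q w"
    and pq: "mset p + mset q = mset_set (cube n)"
    using IH unfolding link2_def by blast
  obtain r where r: "joins w r y2" "mset r = mset_set (cube n)"
    using ham_obtain[of n w y2] w assms by auto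
  show ?thesis
    unfolding link2_def
    using joins_ins[OF p(1)] joins_across[OF q(1) r(1) assms(3)]
      mset_cube_Suc_glue[OF assms(2,3) pq r(2)]
    by (intro exI conjI) (auto simp: ac_simps)
qed

lemma link2_both_crossing:
  assumes "2 \<le> n" "d \<le> n" "s \<noteq> t" "{x1, y1, x2, y2} \<subseteq> cube n"
    and "red x1 = red y1" "red x2 = red y2" "red x1 = red x2" "x1 \<noteq> x2" "y1 \<noteq> y2"
    and IH: "\<And>x1 y1 x2 y2. neutral2 n x1 y1 x2 y2 \<Longrightarrow> link2 n x1 y1 x2 y2"
  shows "link2 (Suc n) (ins d s x1) (ins d t y1) (ins d s x2) (ins d t y2)"
proof -
  obtain w1 where w1: "w1 \<in> cube n" "red w1 \<longleftrightarrow> \<not> red x1"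
    using fresh_vertex[of "[]" n "\<not> red x1"] assms(1) by auto
  obtain w2 where w2: "w2 \<in> cube n" "red w2 \<longleftrightarrow> \<not> red x1" "w2 \<noteq> w1"
    using fresh_vertex[of "[w1]" n "\<not> red x1"] assms(1) by auto
  have "neutral2 n x1 w1 x2 w2" "neutral2 n w1 y1 w2 y2"
    using assms w1 w2 by (auto simp: neutral2_def)
  then obtain p q p' q' where pq: "joins x1 p w1" "joins x2 q w2"
    "mset p + mset q = mset_set (cube n)"
    and pq': "joins w1 p' y1" "joins w2 q' y2" "mset p' + mset q' = mset_set (cube n)"
    using IH unfolding link2_def by meson
  show ?thesis
    unfolding link2_def
    using joins_across[OF pq(1) pq'(1) assms(3)] joins_across[OF pq(2) pq'(2) assms(3)]
      mset_cube_Suc_glue[OF assms(2,3) pq(3) pq'(3)]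
    by (intro exI conjI) (auto simp: ac_simps)
qed

lemma square_adj:
  assumes "a \<in> cube 2" "b \<in> cube 2" "red a \<noteq> red b"
  shows "adj a b"
proof -
  obtain x y z w where "a = [x, y]" "b = [z, w]"
    using assms by (auto simp: cube_def length_Suc_conv numeral_2_eq_2)
  then show ?thesis using assms(3) by auto
qed

lemma link2_square:
  assumes "neutral2 2 a1 b1 a2 b2"
  shows "link2 2 a1 b1 a2 b2"
proof -
  have "mset [a1, b1, a2, b2] = mset_set (cube 2)"
    using assms by (intro mset_eq_mset_cube) (auto simp: neutral2_def)
  then have "mset [a1, b1] + mset [a2, b2] = mset_set (cube 2)" by (simp only: mset_append[symmetric] append.simps)
  then show ?thesis
    unfolding link2_def using square_adj assms
    by (intro exI[of _ "[a1, b1]"] exI[of _ "[a2, b2]"])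
      (auto simp: joins_def neutral2_def simp del: mset.simps)
qed

lemma link2_step_stay:
  assumes n: "2 \<le> n" "d \<le> n" and conf: "neutral2 (Suc n) a1 b1 a2 b2" and stay: "a1 ! d = b1 ! d"
    and IH: "\<And>a1 b1 a2 b2. neutral2 n a1 b1 a2 b2 \<Longrightarrow> link2 n a1 b1 a2 b2"
  shows "link2 (Suc n) a1 b1 a2 b2"
proof -
  have cube: "{a1, b1, a2, b2} \<subseteq> cube (Suc n)" using conf by (simp add: neutral2_def)
  obtain x1 where x1: "x1 \<in> cube n" "a1 = ins d (b1 ! d) x1"
    using obtain_ins[of a1 n d "b1 ! d"] cube n stay by auto
  obtain y1 where y1: "y1 \<in> cube n" "b1 = ins d (b1 ! d) y1"
    using obtain_ins[of b1 n d] cube n by auto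
  obtain x2 where x2: "x2 \<in> cube n" "a2 = ins d (a2 ! d) x2"
    using obtain_ins[of a2 n d] cube n by auto
  obtain y2 where y2: "y2 \<in> cube n" "b2 = ins d (b2 ! d) y2"
    using obtain_ins[of b2 n d] cube n by auto
  define s s2 t2 where s: "s = b1 ! d" and s2: "s2 = a2 ! d" and t2: "t2 = b2 ! d"
  note [simp] = x1(2)[folded s] y1(2)[folded s] x2(2)[folded s2] y2(2)[folded t2]
  have base: "{x1, y1, x2, y2} \<subseteq> cube n" "1 \<le> n" using x1 y1 x2 y2 n by auto
  have 1: "red x1 \<noteq> red y1" and 2: "red x2 \<noteq> red y2 \<longleftrightarrow> s2 = t2"
    and disj: "s2 = s \<Longrightarrow> x2 \<notin> {x1, y1}" "t2 = s \<Longrightarrow> y2 \<notin> {x1, y1}"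
    using conf by (auto simp: neutral2_def)
  show ?thesis
  proof (cases "s2 = t2"; cases "s2 = s")
    assume "s2 = t2" "s2 = s"
    then have "neutral2 n x1 y1 x2 y2" using base 1 2 disj by (auto simp: neutral2_def)
    moreover have "x1 \<noteq> y1" using 1 by auto
    ultimately show ?thesis
      using \<open>s2 = t2\<close> \<open>s2 = s\<close> link2_same_side[of n d s "\<not> s" x1 y1 x2 y2] base n IH by simp
  next
    assume "s2 = t2" "s2 \<noteq> s"
    then show ?thesis using link2_opposite_sides[of n d s t2 x1 y1 x2 y2] base n 1 2 by simp
  next
    assume "s2 \<noteq> t2" "s2 = s"
    then show ?thesis using link2_one_crossing[of n d s t2 x1 y1 x2 y2] base n 1 2 disj IH by simp
  next
    assume "s2 \<noteq> t2" "s2 \<noteq> s"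
    then have "t2 = s" by simp
    with \<open>s2 \<noteq> t2\<close> have "link2 (Suc n) a1 b1 b2 a2"
      using link2_one_crossing[of n d s s2 x1 y1 y2 x2] base n 1 2 disj IH by simp
    then show ?thesis using link2_rev link2_swap by blast
  qed
qed

text \<open>Crossing pairs are handled only when starting vertices of equal colour share a face, because then
  the crossing vertices need not avoid any end. A coordinate with this property exists unless some
  coordinate leaves a pair within a face.\<close>

lemma link2_step:
  assumes n: "2 \<le> n" and conf: "neutral2 (Suc n) a1 b1 a2 b2"
    and IH: "\<And>a1 b1 a2 b2. neutral2 n a1 b1 a2 b2 \<Longrightarrow> link2 n a1 b1 a2 b2"
    and red: "red a1 = red a2"
  shows "link2 (Suc n) a1 b1 a2 b2"
proof (cases "\<exists>d\<le>n. a1 ! d = b1 ! d \<or> a2 ! d = b2 ! d")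
  case True
  then obtain d where "d \<le> n" "a1 ! d = b1 ! d \<or> a2 ! d = b2 ! d" by blast
  moreover have "neutral2 (Suc n) a2 b2 a1 b1" using conf neutral2_swap by blast
  ultimately show ?thesis
    using link2_step_stay[OF n _ conf _ IH] link2_step_stay[OF n _ _ _ IH, of d a2 b2 a1 b1]
      link2_swap by blast
next
  case False
  \<comment> \<open>Otherwise the second pair would be the first one reversed.\<close>
  obtain d where d: "d \<le> n" "b1 ! d \<noteq> a2 ! d"
    using conf differing_coordinate[of b1 n a2] by (auto simp: neutral2_def)
  define s t where s: "s = a1 ! d" and t: "t = b1 ! d"
  have "s \<noteq> t" "a2 ! d = s" "b2 ! d = t" using False d s t by auto
  have cube: "{a1, b1, a2, b2} \<subseteq> cube (Suc n)" using conf by (simp add: neutral2_def)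
  obtain x1 where x1 [simp]: "x1 \<in> cube n" "a1 = ins d s x1"
    using obtain_ins[of a1 n d s] cube d s by auto
  obtain x2 where x2 [simp]: "x2 \<in> cube n" "a2 = ins d s x2"
    using obtain_ins[of a2 n d s] cube d \<open>a2 ! d = s\<close> by auto
  obtain y1 where y1 [simp]: "y1 \<in> cube n" "b1 = ins d t y1"
    using obtain_ins[of b1 n d t] cube d t by auto
  obtain y2 where y2 [simp]: "y2 \<in> cube n" "b2 = ins d t y2"
    using obtain_ins[of b2 n d t] cube d \<open>b2 ! d = t\<close> by auto
  have "red x1 = red y1" "red x2 = red y2" "red x1 = red x2" "x1 \<noteq> x2" "y1 \<noteq> y2"
    using conf red \<open>s \<noteq> t\<close> by (auto simp: neutral2_def)
  then show ?thesis using link2_both_crossing[of n d s t x1 y1 x2 y2] n d \<open>s \<noteq> t\<close> IH by simp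
qed

theorem link2_cube:
  assumes "2 \<le> n" "neutral2 n a1 b1 a2 b2"
  shows "link2 n a1 b1 a2 b2"
  using assms
proof (induction n arbitrary: a1 b1 a2 b2 rule: nat_induct_at_least)
  case base
  then show ?case by (rule link2_square)
next
  case (Suc n)
  show ?case
  proof (cases "red a1 = red a2")
    case True
    then show ?thesis using link2_step[OF Suc.hyps Suc.prems Suc.IH] by blast
  next
    case False
    then have "red a1 = red b2" using Suc.prems by (auto simp: neutral2_def)
    moreover have "neutral2 (Suc n) a1 b1 b2 a2" using Suc.prems by (auto simp: neutral2_def)
    ultimately have "link2 (Suc n) a1 b1 b2 a2"
      using link2_step[OF Suc.hyps _ Suc.IH] by blast
    then show ?thesis using link2_rev link2_swap by blast
  qed
qed

lemma link2_obtain: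
  assumes "2 \<le> n" "neutral2 n a1 b1 a2 b2"
  obtains p q where "joins a1 p b1" "joins a2 q b2" "mset p + mset q = mset_set (cube n)"
  using link2_cube[OF assms] unfolding link2_def by blast

section \<open>Two charged paths of opposite colours\<close>

lemma ham_without_rev: "ham_without n c b a \<Longrightarrow> ham_without n c a b"
  unfolding ham_without_def by (metis joins_rev mset_rev)

lemma ham_without_step:
  assumes "2 \<le> n" "d \<le> n" "s \<noteq> t" "{z, x, y} \<subseteq> cube n" "red z \<noteq> red x" "red x \<noteq> red y"
    and IH: "\<And>w. w \<in> cube n \<Longrightarrow> red w = red x \<Longrightarrow> w \<noteq> x \<Longrightarrow> ham_without n z x w"
  shows "ham_without (Suc n) (ins d s z) (ins d s x) (ins d t y)"
proof -
  obtain w where w: "w \<in> cube n" "red w \<longleftrightarrow> red x" "w \<notin> set [x]"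
    using fresh_vertex[of "[x]" n "red x"] assms(1) by auto
  then obtain p where p: "joins x p w" "add_mset z (mset p) = mset_set (cube n)"
    using IH[of w] unfolding ham_without_def by auto
  obtain q where q: "joins w q y" "mset q = mset_set (cube n)"
    using ham_obtain[of n w y] w assms by auto
  show ?thesis
    unfolding ham_without_def
    using joins_across[OF p(1) q(1) assms(3)] mset_cube_Suc_glue[OF assms(2,3) p(2) q(2)]
    by (intro exI conjI) auto
qed

lemma ham_without_cube:
  assumes "2 \<le> n" "{c, a, b} \<subseteq> cube n" "red a = red b" "red c \<noteq> red a" "a \<noteq> b"
  shows "ham_without n c a b"
  using assms
proof (induction n arbitrary: a b c rule: nat_induct_at_least)
  case base
  obtain z where z: "z \<in> cube 2" "red z \<longleftrightarrow> red c" "z \<notin> set [c]"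
    using fresh_vertex[of "[c]" 2 "red c"] by auto
  then have "adj a z" "adj z b" using base by (auto intro!: square_adj)
  then have "joins a [a, z, b] b" by (simp add: joins_def)
  moreover have "mset [c, a, z, b] = mset_set (cube 2)"
    using base z by (intro mset_eq_mset_cube) auto
  ultimately show ?case unfolding ham_without_def by (metis mset.simps(2))
next
  case (Suc n)
  have step: "ham_without (Suc n) c a b"
    if hyp: "d \<le> n" "a ! d \<noteq> b ! d" "c ! d = a ! d" "{c, a, b} \<subseteq> cube (Suc n)"
      "red a = red b" "red c \<noteq> red a" for d a b
  proof -
    obtain s t where s: "a ! d = s" and t: "b ! d = t" by simp
    obtain x where x: "x \<in> cube n" "a = ins d s x"
      using obtain_ins[of a n d s] hyp s by auto
    obtain y where y: "y \<in> cube n" "b = ins d t y"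
      using obtain_ins[of b n d t] hyp t by auto
    obtain z where z: "z \<in> cube n" "c = ins d s z"
      using obtain_ins[of c n d s] hyp s by auto
    have "s \<noteq> t" using hyp s t by simp
    moreover have "red z \<noteq> red x" "red x \<noteq> red y" using hyp(5,6) \<open>s \<noteq> t\<close> x y z by auto
    ultimately have "ham_without (Suc n) (ins d s z) (ins d s x) (ins d t y)"
      using Suc.hyps hyp x y z by (intro ham_without_step Suc.IH) auto
    then show ?thesis using x y z by simp
  qed
  obtain d where d: "d \<le> n" "a ! d \<noteq> b ! d"
    using Suc.prems differing_coordinate[of a n b] by auto
  show ?case
  proof (cases "c ! d = a ! d")
    case True
    then show ?thesis using step d Suc.prems by blast
  next
    case False
    then have "ham_without (Suc n) c b a" using step[of d b a] d Suc.prems by auto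
    then show ?thesis by (rule ham_without_rev)
  qed
qed

lemma ham_without_obtain:
  assumes "2 \<le> n" "{c, a, b} \<subseteq> cube n" "red a = red b" "red c \<noteq> red a" "a \<noteq> b"
  obtains p where "joins a p b" "add_mset c (mset p) = mset_set (cube n)"
  using ham_without_cube[OF assms] unfolding ham_without_def by blast

definition charged2 :: "nat \<Rightarrow> vertex \<Rightarrow> vertex \<Rightarrow> vertex \<Rightarrow> vertex \<Rightarrow> bool" where
  "charged2 n a1 b1 a2 b2 \<longleftrightarrow> {a1, b1, a2, b2} \<subseteq> cube n \<and> red a1 = red b1 \<and> red a2 = red b2 \<and>
    red a1 \<noteq> red a2 \<and> a1 \<noteq> b1 \<and> a2 \<noteq> b2"

text \<open>The path is alternating, so it can be cut after its first, third or fifth vertex; each of the two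
  forbidden vertices excludes at most one of these cuts.\<close>

lemma cut_avoiding:
  assumes "joins x p y" "red x \<noteq> red y" "distinct p" "6 \<le> length p"
  obtains p1 p2 u v where "p = p1 @ p2" "joins x p1 u" "joins v p2 y"
    "red u = red x" "red v = red y" "u \<noteq> f" "v \<noteq> g"
proof -
  obtain q0 q1 q2 q3 q4 q5 r where p: "p = q0 # q1 # q2 # q3 # q4 # q5 # r"
    using assms(4) by (auto simp: Suc_le_length_iff eval_nat_numeral)
  have "joins x [q0] q0" "joins q1 (q1 # q2 # q3 # q4 # q5 # r) y"
    "joins x [q0, q1, q2] q2" "joins q3 (q3 # q4 # q5 # r) y"
    "joins x [q0, q1, q2, q3, q4] q4" "joins q5 (q5 # r) y"
    using assms(1) by (auto simp: p joins_def)
  moreover have "red q0 = red x" "red q2 = red x" "red q4 = red x"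
     "red q1 = red y" "red q3 = red y" "red q5 = red y"
    using assms(1,2) by (auto simp: p joins_def dest!: adj_red)
  moreover have "(q0 \<noteq> f \<and> q1 \<noteq> g) \<or> (q2 \<noteq> f \<and> q3 \<noteq> g) \<or> (q4 \<noteq> f \<and> q5 \<noteq> g)"
    using assms(3) p by auto
  ultimately show ?thesis
    using that[of "[q0]" _ q0 q1] that[of "[q0, q1, q2]" _ q2 q3]
      that[of "[q0, q1, q2, q3, q4]" _ q4 q5] p by auto
qed

text \<open>The path of the second pair covers all of the face of \<open>x1\<close> except \<open>x1\<close>, from which the first path
  crosses immediately.\<close>

lemma charged2_same_side:
  assumes "2 \<le> n" "d \<le> n" "s \<noteq> t" "{x1, y1, x2, y2} \<subseteq> cube n"
    and "red x1 \<noteq> red y1" "red x2 = red y2" "red x1 \<noteq> red x2" "x2 \<noteq> y2"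
  shows "link2 (Suc n) (ins d s x1) (ins d t y1) (ins d s x2) (ins d s y2)"
proof -
  obtain q where q: "joins x2 q y2" "add_mset x1 (mset q) = mset_set (cube n)"
    using ham_without_obtain[of n x1 x2 y2] assms by auto
  obtain p where p: "joins x1 p y1" "mset p = mset_set (cube n)"
    using ham_obtain[of n x1 y1] assms by auto
  have "joins (ins d s x1) (ins d s x1 # map (ins d t) p) (ins d t y1)"
    using joins_Cons adj_ins_across[OF assms(3)] joins_ins[OF p(1)] by blast
  then show ?thesis
    unfolding link2_def
    using joins_ins[OF q(1)] mset_cube_Suc_glue[OF assms(2,3) q(2) p(2)]
    by (intro exI conjI) (auto simp: ac_simps)
qed

text \<open>In the face of \<open>x1\<close> and \<open>x2\<close> take a single Hamiltonian path between them and cut it: the two ends of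
  the missing edge continue as two neutral pairs in the opposite face, provided that they avoid
  \<open>y1\<close> and \<open>y2\<close>.\<close>

lemma charged2_crossing:
  assumes "3 \<le> n" "d \<le> n" "s \<noteq> t" "{x1, y1, x2, y2} \<subseteq> cube n"
    and "red x1 \<noteq> red y1" "red x2 \<noteq> red y2" "red x1 \<noteq> red x2"
  shows "link2 (Suc n) (ins d s x1) (ins d t y1) (ins d s x2) (ins d t y2)"
proof -
  obtain p where p: "joins x1 p x2" "mset p = mset_set (cube n)"
    using ham_obtain[of n x1 x2] assms by auto
  have "distinct p" using p(2) by (rule distinct_if_mset_set) simp
  have "length p = 2 ^ n" using arg_cong[OF p(2), of size] by simp
  moreover have "(2 ^ 3 :: nat) \<le> 2 ^ n" using assms(1) by (intro power_increasing) auto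
  ultimately have "6 \<le> length p" by simp
  obtain p1 p2 u v where p12: "p = p1 @ p2" "joins x1 p1 u" "joins v p2 x2"
    "red u = red x1" "red v = red x2" "u \<noteq> y2" "v \<noteq> y1"
    by (rule cut_avoiding[OF p(1) assms(7) \<open>distinct p\<close> \<open>6 \<le> length p\<close>, where f = y2 and g = y1])
  have "set p = cube n" using arg_cong[OF p(2), of set_mset] by simp
  then have "u \<in> cube n" "v \<in> cube n" using p12 joins_ends by fastforce+
  then have "neutral2 n u y1 v y2" using assms p12 by (auto simp: neutral2_def)
  then obtain q1 q2 where q: "joins u q1 y1" "joins v q2 y2" "mset q1 + mset q2 = mset_set (cube n)"
    using link2_obtain[of n u y1 v y2] assms(1) by auto
  show ?thesis
    unfolding link2_def
    using joins_across[OF p12(2) q(1) assms(3)] joins_across[OF joins_rev[OF p12(3)] q(2) assms(3)]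
      mset_cube_Suc_glue[OF assms(2,3) p(2) q(3)]
    by (intro exI conjI) (auto simp: p12(1) ac_simps)
qed

lemma link2_charged_aux:
  assumes "3 \<le> n" "charged2 (Suc n) a1 b1 a2 b2" "d \<le> n" "a1 ! d \<noteq> b1 ! d" "a2 ! d = a1 ! d"
  shows "link2 (Suc n) a1 b1 a2 b2"
proof -
  have cube: "{a1, b1, a2, b2} \<subseteq> cube (Suc n)" using assms by (simp add: charged2_def)
  obtain s t where s: "a1 ! d = s" and t: "b1 ! d = t" by simp
  have st: "s \<noteq> t" "2 \<le> n" "d \<le> n" using assms s t by auto
  obtain x1 where x1: "x1 \<in> cube n" "a1 = ins d s x1"
    using obtain_ins[of a1 n d s] cube assms s by auto
  obtain y1 where y1: "y1 \<in> cube n" "b1 = ins d t y1"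
    using obtain_ins[of b1 n d t] cube assms t by auto
  obtain x2 where x2: "x2 \<in> cube n" "a2 = ins d s x2"
    using obtain_ins[of a2 n d s] cube assms s by auto
  note [simp] = x1 y1 x2
  have ne: "red x1 \<noteq> red y1" "red x1 \<noteq> red x2"
    using assms(2) st by (auto simp: charged2_def)
  show ?thesis
  proof (cases "b2 ! d = s")
    case True
    then obtain y2 where y2 [simp]: "y2 \<in> cube n" "b2 = ins d s y2"
      using obtain_ins[of b2 n d s] cube assms by auto
    have "red x2 = red y2" "x2 \<noteq> y2" using assms(2) st by (auto simp: charged2_def)
    then show ?thesis using charged2_same_side[of n d s t x1 y1 x2 y2] st ne by simp
  next
    case False
    then obtain y2 where y2 [simp]: "y2 \<in> cube n" "b2 = ins d t y2"
      using obtain_ins[of b2 n d t] cube assms st by auto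
    have "red x2 \<noteq> red y2" using assms(2) st by (auto simp: charged2_def)
    then show ?thesis using charged2_crossing[of n d s t x1 y1 x2 y2] st ne assms(1) by simp
  qed
qed

theorem link2_charged:
  assumes "4 \<le> n" "charged2 n a1 b1 a2 b2"
  shows "link2 n a1 b1 a2 b2"
proof -
  obtain m where n: "n = Suc m" "3 \<le> m" using assms(1) by (cases n) auto
  obtain d where d: "d \<le> m" "a1 ! d \<noteq> b1 ! d"
    using assms(2) n differing_coordinate[of a1 m b1] by (auto simp: charged2_def)
  show ?thesis
  proof (cases "a2 ! d = a1 ! d")
    case True
    then show ?thesis using link2_charged_aux[OF n(2)] assms(2) n d by simp
  next
    case False
    moreover have "charged2 n b1 a1 a2 b2" using assms(2) by (auto simp: charged2_def)
    ultimately have "link2 n b1 a1 a2 b2"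
      using link2_charged_aux[OF n(2), of b1 a1 a2 b2 d] n d by auto
    then show ?thesis by (rule link2_rev)
  qed
qed

section \<open>Three neutral paths, relative to one coordinate\<close>

text \<open>A pair of equal vertices stands for a path with one vertex. Admitting it spares a separate
  discussion of the cases in which a path is already finished when it enters a face.\<close>

lemma link2_charged_or_trivial:
  assumes "4 \<le> n" "{a1, b1, a2, b2} \<subseteq> cube n" "red a1 = red b1" "red a2 = red b2"
    "red a1 \<noteq> red a2" "a1 \<noteq> b1 \<or> a2 \<noteq> b2"
  shows "link2 n a1 b1 a2 b2"
proof -
  consider "a1 = b1" "a2 \<noteq> b2" | "a1 \<noteq> b1" "a2 = b2" | "a1 \<noteq> b1" "a2 \<noteq> b2"
    using assms(6) by blast
  then show ?thesis
  proof cases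
    case 1
    then obtain p where "joins a2 p b2" "add_mset a1 (mset p) = mset_set (cube n)"
      using ham_without_obtain[of n a1 a2 b2] assms by auto
    then show ?thesis
      unfolding link2_def using 1 by (intro exI[of _ "[a1]"] exI[of _ p]) auto
  next
    case 2
    then obtain p where "joins a1 p b1" "add_mset a2 (mset p) = mset_set (cube n)"
      using ham_without_obtain[of n a2 a1 b1] assms by auto
    then show ?thesis
      unfolding link2_def using 2 by (intro exI[of _ p] exI[of _ "[a2]"]) auto
  next
    case 3
    then show ?thesis using assms by (intro link2_charged) (auto simp: charged2_def)
  qed
qed

definition link3 :: "nat \<Rightarrow> vertex \<Rightarrow> vertex \<Rightarrow> vertex \<Rightarrow> vertex \<Rightarrow> vertex \<Rightarrow> vertex \<Rightarrow> bool" where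
  "link3 n a1 b1 a2 b2 a3 b3 \<longleftrightarrow>
    (\<exists>p1 p2 p3. joins a1 p1 b1 \<and> joins a2 p2 b2 \<and> joins a3 p3 b3 \<and>
      mset p1 + mset p2 + mset p3 = mset_set (cube n))"

lemma link3I:
  assumes "joins a1 p1 b1" "joins a2 p2 b2" "joins a3 p3 b3"
    "mset p1 + mset p2 + mset p3 = mset_set (cube n)"
  shows "link3 n a1 b1 a2 b2 a3 b3"
  using assms unfolding link3_def by blast

lemma link3_swap12: "link3 n a2 b2 a1 b1 a3 b3 \<Longrightarrow> link3 n a1 b1 a2 b2 a3 b3"
  unfolding link3_def by (metis add.commute)

lemma link3_swap23: "link3 n a1 b1 a3 b3 a2 b2 \<Longrightarrow> link3 n a1 b1 a2 b2 a3 b3"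
  unfolding link3_def by (metis add.commute add.assoc)

lemma link3_rev2: "link3 n a1 b1 b2 a2 a3 b3 \<Longrightarrow> link3 n a1 b1 a2 b2 a3 b3"
  unfolding link3_def by (metis joins_rev mset_rev)

lemma link3_rev3: "link3 n a1 b1 a2 b2 b3 a3 \<Longrightarrow> link3 n a1 b1 a2 b2 a3 b3"
  unfolding link3_def by (metis joins_rev mset_rev)

lemma link3_opposite_sides:
  assumes "2 \<le> n" "d \<le> n" "s \<noteq> t" "{x2, y2} \<subseteq> cube n"
    "red x2 \<noteq> red y2" "neutral2 n x1 y1 x3 y3"
  shows "link3 (Suc n) (ins d s x1) (ins d s y1) (ins d t x2) (ins d t y2) (ins d s x3) (ins d s y3)"
proof -
  obtain p1 p3 where p: "joins x1 p1 y1" "joins x3 p3 y3" "mset p1 + mset p3 = mset_set (cube n)"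
    using link2_obtain[OF assms(1,6)] .
  obtain q where q: "joins x2 q y2" "mset q = mset_set (cube n)"
    using ham_obtain[of n x2 y2] assms by auto
  show ?thesis
    using mset_cube_Suc_glue[OF assms(2,3) p(3) q(2)]
    by (intro link3I[OF joins_ins[OF p(1)] joins_ins[OF q(1)] joins_ins[OF p(2)]])
      (auto simp: ac_simps)
qed

lemma link3_opposite_sides_crossing:
  assumes "3 \<le> n" "d \<le> n" "s \<noteq> t" "{x1, y1, x2, y2, x3, y3} \<subseteq> cube n"
    "red x1 \<noteq> red y1" "red x2 \<noteq> red y2" "red x3 = red y3" "x3 \<notin> {x1, y1}" "y3 \<notin> {x2, y2}"
  shows "link3 (Suc n) (ins d s x1) (ins d s y1) (ins d t x2) (ins d t y2) (ins d s x3) (ins d t y3)"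
proof -
  obtain w where w: "w \<in> cube n" "red w \<longleftrightarrow> \<not> red x3" "w \<notin> {x1, y1, x2, y2}"
    using fresh_vertex_avoiding_pairs[OF assms(1,5,6)] .
  have *: "neutral2 n x1 y1 x3 w" "neutral2 n x2 y2 w y3"
    using assms w by (auto simp: neutral2_def)
  have "2 \<le> n" using assms(1) by simp
  obtain p1 p3 where p: "joins x1 p1 y1" "joins x3 p3 w" "mset p1 + mset p3 = mset_set (cube n)"
    using link2_obtain[OF \<open>2 \<le> n\<close> *(1)] .
  obtain q2 q3 where q: "joins x2 q2 y2" "joins w q3 y3" "mset q2 + mset q3 = mset_set (cube n)"
    using link2_obtain[OF \<open>2 \<le> n\<close> *(2)] .
  show ?thesis
    using mset_cube_Suc_glue[OF assms(2,3) p(3) q(3)]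
    by (intro link3I[OF joins_ins[OF p(1)] joins_ins[OF q(1)] joins_across[OF p(2) q(2) assms(3)]])
      (auto simp: ac_simps)
qed

text \<open>The neighbours of an inner vertex of a path, used to bypass it.\<close>

lemma joins_around:
  assumes "joins a p b" "x \<in> set p" "x \<noteq> a" "x \<noteq> b"
  obtains p1 p2 u v where "p = p1 @ x # p2" "joins a p1 u" "adj u x" "adj x v" "joins v p2 b"
proof -
  obtain p1 p2 where p: "p = p1 @ x # p2" using assms(2) by (meson split_list)
  then have "p1 \<noteq> []" "p2 \<noteq> []" using assms by (auto simp: joins_def)
  have "joins a (p1 @ x # p2) b" using assms(1) p by simp
  then obtain u u' where "joins a p1 u" "adj u u'" "joins u' (x # p2) b"
    using \<open>p1 \<noteq> []\<close> by (rule joins_split) simp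
  then have u: "joins a p1 u" "adj u x" "joins x (x # p2) b" by (auto simp: joins_def)
  obtain v where "adj x v" "joins v p2 b"
    using joins_first_edge[OF u(3) assms(4)] by auto
  then show ?thesis using that p u by blast
qed

text \<open>The vertex \<open>x3\<close> is taken out of the path through it. Both the bypass, from \<open>u\<close> to \<open>v\<close>, and the remainder
  of the third path, from \<open>x3\<close> to \<open>y3\<close>, run through the opposite face, where they are charged and of
  opposite colours.\<close>

lemma link3_detour:
  assumes "4 \<le> n" "d \<le> n" "s \<noteq> t" "{x3, y3} \<subseteq> cube n" "red x3 = red y3" "x3 \<notin> {x1, y1}"
    and p: "joins x1 p1 y1" "joins x2 p2 y2" "mset p1 + mset p2 = mset_set (cube n)"
    and x3: "x3 \<in> set p1"
  shows "link3 (Suc n) (ins d s x1) (ins d s y1) (ins d s x2) (ins d s y2) (ins d s x3) (ins d t y3)"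
proof -
  have "x3 \<noteq> x1" "x3 \<noteq> y1" using assms(6) by auto
  then obtain q q' u v where q: "p1 = q @ x3 # q'" "joins x1 q u" "adj u x3" "adj x3 v" "joins v q' y1"
    by (rule joins_around[OF p(1) x3])
  have "mset (p1 @ p2) = mset_set (cube n)" using p(3) by simp
  then have "distinct (p1 @ p2)" by (rule distinct_if_mset_set) simp
  then have "u \<noteq> v" using q joins_ends[OF q(2)] joins_ends[OF q(5)] by auto
  have "red u \<noteq> red x3" "red v \<noteq> red x3" using adj_red[OF q(3)] adj_red[OF q(4)] by auto
  moreover have "u \<in> cube n" "v \<in> cube n"
    using adj_length[OF q(3)] adj_length[OF q(4)] assms(4) by (auto simp: cube_def)
  ultimately obtain r r3 where r: "joins u r v" "joins x3 r3 y3" "mset r + mset r3 = mset_set (cube n)"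
    using link2_charged_or_trivial[of n u v x3 y3] assms \<open>u \<noteq> v\<close> unfolding link2_def by auto
  have "joins (ins d s x1) (map (ins d s) q @ map (ins d t) r @ map (ins d s) q') (ins d s y1)"
    using joins_append[OF joins_ins[OF q(2)] adj_ins_across[OF assms(3)]
        joins_append[OF joins_ins[OF r(1)] adj_ins_across joins_ins[OF q(5)]]] assms(3) by blast
  moreover have "joins (ins d s x3) (ins d s x3 # map (ins d t) r3) (ins d t y3)"
    using joins_Cons adj_ins_across[OF assms(3)] joins_ins[OF r(2)] by blast
  ultimately show ?thesis
    using joins_ins[OF p(2)] mset_cube_Suc_glue[OF assms(2,3) p(3) r(3)]
    by (intro link3I) (auto simp: q(1) ac_simps)
qed

lemma link3_two_inside:
  assumes "4 \<le> n" "d \<le> n" "s \<noteq> t" "{x3, y3} \<subseteq> cube n" "neutral2 n x1 y1 x2 y2"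
    "red x3 = red y3" "x3 \<notin> {x1, y1, x2, y2}"
  shows "link3 (Suc n) (ins d s x1) (ins d s y1) (ins d s x2) (ins d s y2) (ins d s x3) (ins d t y3)"
proof -
  obtain p1 p2 where p: "joins x1 p1 y1" "joins x2 p2 y2" "mset p1 + mset p2 = mset_set (cube n)"
    using link2_obtain[OF _ assms(5)] assms(1) by auto
  have "set p1 \<union> set p2 = cube n" using arg_cong[OF p(3), of set_mset] by simp
  then consider "x3 \<in> set p1" | "x3 \<in> set p2" using assms(4) by blast
  then show ?thesis
  proof cases
    case 1
    then show ?thesis using link3_detour[OF assms(1-4,6) _ p] assms(7) by blast
  next
    case 2
    have "mset p2 + mset p1 = mset_set (cube n)" using p(3) by (simp add: add.commute)
    then show ?thesis
      using link3_detour[OF assms(1-4,6) _ p(2,1)] 2 assms(7) link3_swap12 by blast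
  qed
qed


text \<open>A coordinate that separates \<open>a2\<close> from \<open>a3\<close> leaves at most two paths in each half, whatever the position
  of the remaining pair.\<close>

lemma link3_free_ends_aux:
  assumes n: "3 \<le> n" "d \<le> n" and cube: "{a1, b1, a2, a3} \<subseteq> cube (Suc n)"
    and red: "red a1 \<noteq> red b1" "red a2 = red a3" and disj: "{a1, b1} \<inter> {a2, a3} = {}"
    and sides: "a2 ! d \<noteq> a3 ! d" "a1 ! d = a2 ! d"
  shows "\<exists>w2 w3. {w2, w3} \<subseteq> cube (Suc n) \<and> red w2 \<noteq> red a2 \<and> red w3 \<noteq> red a3 \<and>
    link3 (Suc n) a1 b1 a2 w2 a3 w3"
proof -
  obtain s t where s: "a2 ! d = s" and t: "a3 ! d = t" by simp
  have st: "s \<noteq> t" "2 \<le> n" "1 \<le> n" using sides s t n by auto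
  obtain x1 where x1: "x1 \<in> cube n" "a1 = ins d s x1"
    using obtain_ins[of a1 n d s] cube sides n s by auto
  obtain x2 where x2: "x2 \<in> cube n" "a2 = ins d s x2"
    using obtain_ins[of a2 n d s] cube n s by auto
  obtain x3 where x3: "x3 \<in> cube n" "a3 = ins d t x3"
    using obtain_ins[of a3 n d t] cube n t by auto
  note [simp] = x1 x2 x3
  have ne: "x1 \<noteq> x2" "red x2 \<noteq> red x3" using red disj st by auto
  show ?thesis
  proof (cases "b1 ! d = s")
    case True
    then obtain y1 where y1 [simp]: "y1 \<in> cube n" "b1 = ins d s y1"
      using obtain_ins[of b1 n d s] cube n by auto
    obtain w2 where w2: "w2 \<in> cube n" "red w2 \<longleftrightarrow> \<not> red x2" "w2 \<notin> set [x1, y1]"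
      using fresh_vertex[of "[x1, y1]" n "\<not> red x2"] n by auto
    obtain w3 where w3: "w3 \<in> cube n" "red w3 \<longleftrightarrow> \<not> red x3"
      using fresh_vertex[of "[]" n "\<not> red x3"] n by auto
    have "neutral2 n x1 y1 x2 w2" using red disj ne w2 n by (auto simp: neutral2_def)
    then have "link3 (Suc n) a1 b1 a3 (ins d t w3) a2 (ins d s w2)"
      using link3_opposite_sides[of n d s t x3 w3 x1 y1 x2 w2] n st w3 by simp
    then show ?thesis using w2 w3 link3_swap23
      by (intro exI[of _ "ins d s w2"] exI[of _ "ins d t w3"]) auto
  next
    case False
    then obtain y1 where y1 [simp]: "y1 \<in> cube n" "b1 = ins d t y1"
      using obtain_ins[of b1 n d t] cube n st by auto
    have ne': "red x1 = red y1" "y1 \<noteq> x3" using red disj st by auto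
    obtain z where z: "z \<in> cube n" "red z \<longleftrightarrow> \<not> red x1" "z \<notin> set [x2, x3]"
      using fresh_vertex[of "[x2, x3]" n "\<not> red x1"] n by auto
    \<comment> \<open>The first path crosses at \<open>z\<close>; the free ends have to avoid it.\<close>
    obtain w2 where w2: "w2 \<in> cube n" "red w2 \<longleftrightarrow> \<not> red x2" "w2 \<notin> set [x1, z]"
      using fresh_vertex[of "[x1, z]" n "\<not> red x2"] n by auto
    obtain w3 where w3: "w3 \<in> cube n" "red w3 \<longleftrightarrow> \<not> red x3" "w3 \<notin> set [y1, z]"
      using fresh_vertex[of "[y1, z]" n "\<not> red x3"] n by auto
    have *: "neutral2 n x1 z x2 w2" "neutral2 n z y1 x3 w3"
      using ne ne' z w2 w3 by (auto simp: neutral2_def)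
    obtain p p2 where p: "joins x1 p z" "joins x2 p2 w2" "mset p + mset p2 = mset_set (cube n)"
      using link2_obtain[OF st(2) *(1)] .
    obtain q q3 where q: "joins z q y1" "joins x3 q3 w3" "mset q + mset q3 = mset_set (cube n)"
      using link2_obtain[OF st(2) *(2)] .
    have "link3 (Suc n) a1 b1 a2 (ins d s w2) a3 (ins d t w3)"
      using mset_cube_Suc_glue[OF n(2) st(1) p(3) q(3)] unfolding x1 x2 x3 y1
      by (intro link3I[OF joins_across[OF p(1) q(1) st(1)] joins_ins[OF p(2)] joins_ins[OF q(2)]])
        (auto simp: ac_simps)
    then show ?thesis using w2 w3
      by (intro exI[of _ "ins d s w2"] exI[of _ "ins d t w3"]) auto
  qed
qed

lemma link3_free_ends:
  assumes n: "4 \<le> n" and cube: "{a1, b1, a2, a3} \<subseteq> cube n"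
    and red: "red a1 \<noteq> red b1" "red a2 = red a3" and disj: "{a1, b1} \<inter> {a2, a3} = {}"
    and "a2 \<noteq> a3"
  shows "\<exists>w2 w3. {w2, w3} \<subseteq> cube n \<and> red w2 \<noteq> red a2 \<and> red w3 \<noteq> red a3 \<and> link3 n a1 b1 a2 w2 a3 w3"
proof -
  obtain m where m: "n = Suc m" "3 \<le> m" using n by (cases n) auto
  obtain d where d: "d \<le> m" "a2 ! d \<noteq> a3 ! d"
    using differing_coordinate[of a2 m a3] cube m \<open>a2 \<noteq> a3\<close> by auto
  show ?thesis
  proof (cases "a1 ! d = a2 ! d")
    case True
    then show ?thesis
      using link3_free_ends_aux[OF m(2) d(1), of a1 b1 a2 a3] cube red disj m d by auto
  next
    case False
    then obtain w3 w2 where "{w3, w2} \<subseteq> cube (Suc m)" "red w3 \<noteq> red a3" "red w2 \<noteq> red a2"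
        "link3 (Suc m) a1 b1 a3 w3 a2 w2"
      using link3_free_ends_aux[OF m(2) d(1), of a1 b1 a3 a2] cube red disj m d by auto
    then show ?thesis using link3_swap23 m by (intro exI[of _ w2] exI[of _ w3]) auto
  qed
qed

text \<open>The edge between \<open>u\<close> and \<open>v\<close> is removed from a path between \<open>x2\<close> and \<open>x3\<close>; in the opposite face \<open>u\<close> and \<open>v\<close>
  are then joined to \<open>y2\<close> and \<open>y3\<close> by charged paths.\<close>

lemma link3_cut:
  assumes "4 \<le> n" "d \<le> n" "s \<noteq> t" "{u, v, y2, y3} \<subseteq> cube n"
    and "red u = red y2" "red v = red y3" "red y2 \<noteq> red y3" "u \<noteq> y2 \<or> v \<noteq> y3"
    and p: "joins x1 p y1" "joins x2 q u" "joins x3 r v"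
      "mset p + (mset q + mset r) = mset_set (cube n)"
  shows "link3 (Suc n) (ins d s x1) (ins d s y1) (ins d s x2) (ins d t y2) (ins d s x3) (ins d t y3)"
proof -
  obtain q' r' where q': "joins u q' y2" "joins v r' y3" "mset q' + mset r' = mset_set (cube n)"
    using link2_charged_or_trivial[of n u y2 v y3] assms unfolding link2_def by auto
  show ?thesis
    using mset_cube_Suc_glue[OF assms(2,3) p(4) q'(3)]
    by (intro link3I[OF joins_ins[OF p(1)] joins_across[OF p(2) q'(1) assms(3)]
          joins_across[OF p(3) q'(2) assms(3)]]) (auto simp: ac_simps)
qed

text \<open>The ends at which the second and third path leave their face may be chosen freely, as any two vertices
  of the right colour can be continued in the opposite face.\<close>

lemma link3_two_crossing_charged:
  assumes "4 \<le> n" "d \<le> n" "s \<noteq> t" "{x1, y1, x2, x3, y2, y3} \<subseteq> cube n"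
    and "red x1 \<noteq> red y1" "{x1, y1} \<inter> {x2, x3} = {}"
    and "red x2 = red y2" "red x3 = red y3" "red x2 = red x3" "x2 \<noteq> x3" "y2 \<noteq> y3"
  shows "link3 (Suc n) (ins d s x1) (ins d s y1) (ins d s x2) (ins d t y2) (ins d s x3) (ins d t y3)"
proof -
  obtain w2 w3 where w: "{w2, w3} \<subseteq> cube n" "red w2 \<noteq> red x2" "red w3 \<noteq> red x3"
    "link3 n x1 y1 x2 w2 x3 w3"
    using link3_free_ends[of n x1 y1 x2 x3] assms by auto
  then obtain p1 p2 p3 where p: "joins x1 p1 y1" "joins x2 p2 w2" "joins x3 p3 w3"
    "mset p1 + mset p2 + mset p3 = mset_set (cube n)"
    unfolding link3_def by blast
  have "mset (p1 @ p2 @ p3) = mset_set (cube n)" using p(4) by (simp add: ac_simps)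
  then have "distinct (p1 @ p2 @ p3)" by (rule distinct_if_mset_set) simp
  then have "w2 \<noteq> w3" using joins_ends[OF p(2)] joins_ends[OF p(3)] by auto
  then have "neutral2 n w2 y2 w3 y3" using w assms by (auto simp: neutral2_def)
  then obtain q2 q3 where q: "joins w2 q2 y2" "joins w3 q3 y3" "mset q2 + mset q3 = mset_set (cube n)"
    using link2_obtain[of n w2 y2 w3 y3] assms(1) by auto
  show ?thesis
    using mset_cube_Suc_glue[OF assms(2,3) p(4) q(3)]
    by (intro link3I[OF joins_ins[OF p(1)] joins_across[OF p(2) q(1) assms(3)]
          joins_across[OF p(3) q(2) assms(3)]]) (auto simp: ac_simps)
qed

text \<open>A path between \<open>x2\<close> and \<open>x3\<close> is cut at its first or at its last edge. If the first cut fails then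
  \<open>x2 = y2\<close>, and if the last one fails then \<open>x3 = y3\<close>.\<close>

lemma link3_two_crossing_neutral:
  assumes "4 \<le> n" "d \<le> n" "s \<noteq> t" "{y2, y3} \<subseteq> cube n" "neutral2 n x1 y1 x2 x3"
    and red: "red x2 = red y2" "red x3 = red y3" and ne: "\<not> (x2 = y2 \<and> x3 = y3)"
  shows "link3 (Suc n) (ins d s x1) (ins d s y1) (ins d s x2) (ins d t y2) (ins d s x3) (ins d t y3)"
proof -
  obtain p q where p: "joins x1 p y1" "joins x2 q x3" "mset p + mset q = mset_set (cube n)"
    using link2_obtain[of n x1 y1 x2 x3] assms by auto
  have x: "x2 \<in> cube n" "x3 \<in> cube n" "red x2 \<noteq> red x3" "x2 \<noteq> x3"
    using assms(5) by (auto simp: neutral2_def)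
  have cut: "link3 (Suc n) (ins d s x1) (ins d s y1) (ins d s x2) (ins d t y2) (ins d s x3) (ins d t y3)"
    if "q = q1 @ q2" "joins x2 q1 u" "adj u v" "joins v q2 x3" "red u = red x2" "u \<in> cube n"
      "u \<noteq> y2 \<or> v \<noteq> y3" for q1 q2 u v
  proof (rule link3_cut[OF assms(1-3), of u v])
    show "joins x3 (rev q2) v" using that(4) by (rule joins_rev)
    show "{u, v, y2, y3} \<subseteq> cube n" using assms(4) that adj_length[of u v] by (auto simp: cube_def)
    show "red v = red y3" using adj_red[OF that(3)] that red x by auto
    show "mset p + (mset q1 + mset (rev q2)) = mset_set (cube n)"
      using p(3) that(1) by simp
  qed (use p that red x in auto)
  obtain v q2 where first: "q = x2 # q2" "adj x2 v" "joins v q2 x3"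
    using joins_first_edge[OF p(2) x(4)] .
  obtain u q1 where "rev q = x3 # q1" "adj x3 u" "joins u q1 x2"
    using joins_first_edge[OF joins_rev[OF p(2)] x(4)[symmetric]] .
  then have last: "q = rev q1 @ [x3]" "adj u x3" "joins x2 (rev q1) u"
    using arg_cong[OF \<open>rev q = x3 # q1\<close>, of rev] adj_sym joins_rev by auto
  have "u \<in> cube n" "red u = red x2"
    using x adj_length[OF last(2)] adj_red[OF last(2)] by (auto simp: cube_def)
  show ?thesis
  proof (cases "x2 = y2 \<and> v = y3")
    case True
    then have "u \<noteq> y2 \<or> x3 \<noteq> y3" using ne by auto
    then show ?thesis using cut[of "rev q1" "[x3]" u x3] last \<open>u \<in> cube n\<close> \<open>red u = red x2\<close> by simp
  next
    case False
    then show ?thesis using cut[of "[x2]" q2 x2 v] first x by simp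
  qed
qed

section \<open>Three neutral paths in dimension at least five\<close>

text \<open>Two paths cover the at least eight vertices, so one of them has four vertices and can be cut after its
  second vertex.\<close>

lemma split_cube_three:
  assumes "3 \<le> n" "{u, v} \<subseteq> cube n" "red u \<noteq> red v"
  obtains p1 p2 p3 p q c d where "joins u p1 p" "joins q p2 c" "joins d p3 v"
    "mset p1 + mset p2 + mset p3 = mset_set (cube n)"
    "red p = red v" "red q = red u" "red c = red v" "red d = red u"
proof -
  obtain c where c: "c \<in> cube n" "red c \<longleftrightarrow> red v" "c \<notin> set [v]"
    using fresh_vertex[of "[v]" n "red v"] assms(1) by auto
  obtain d where d: "d \<in> cube n" "red d \<longleftrightarrow> red u" "d \<notin> set [u]"
    using fresh_vertex[of "[u]" n "red u"] assms(1) by auto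
  have "neutral2 n u c d v" using assms c d by (auto simp: neutral2_def)
  then obtain P Q where P: "joins u P c" and Q: "joins d Q v"
    and PQ: "mset P + mset Q = mset_set (cube n)"
    using link2_obtain[of n u c d v] assms(1) by auto
  have "length P + length Q = 2 ^ n" using arg_cong[OF PQ, of size] by simp
  moreover have "(2 ^ 3 :: nat) \<le> 2 ^ n" using assms(1) by (intro power_increasing) auto
  ultimately consider "4 \<le> length P" | "4 \<le> length Q" by fastforce
  then show ?thesis
  proof cases
    case 1
    then obtain x y z r where *: "P = x # y # z # r"
      by (auto simp: Suc_le_length_iff eval_nat_numeral)
    then have "joins u [x, y] y" "joins z (z # r) c" "red y = red v" "red z = red u"
      using P assms(3) by (auto simp: joins_def dest!: adj_red)
    then show ?thesis using that[of "[x, y]" y z "z # r" c d Q] Q PQ * c d by (simp add: add_mset_commute)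
  next
    case 2
    then obtain x y z r where *: "Q = x # y # z # r"
      by (auto simp: Suc_le_length_iff eval_nat_numeral)
    then have "joins d [x, y] y" "joins z (z # r) v" "red y = red v" "red z = red u"
      using Q assms(3) d by (auto simp: joins_def dest!: adj_red)
    then show ?thesis using that[of P c d "[x, y]" y z "z # r"] P PQ * c d by (simp add: add_mset_commute)
  qed
qed

text \<open>Write \<open>f i j\<close> for the embedding of \<open>Q\<^sub>m\<close> as the quarter in which the two coordinates are \<open>i\<close> and \<open>j\<close>. The
  routes are
  \<^item> first path: quarters \<open>s t\<close>, \<open>s t'\<close>, \<open>s' t'\<close>;
  \<^item> second path: quarters \<open>s' t\<close>, \<open>s t\<close>, \<open>s t'\<close>;
  \<^item> third path: quarters \<open>s t'\<close>, \<open>s' t'\<close>, \<open>s' t\<close>.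

  Only the quarter \<open>s t'\<close> is visited by all three, but there the first path merely passes through, and
  all ends except \<open>u3\<close> and \<open>v2\<close> are free. The other quarters carry two neutral paths each.\<close>

lemma link3_quadrants:
  assumes m: "3 \<le> m" "d \<le> Suc m" "e \<le> m" "s \<noteq> s'" "t \<noteq> t'"
    and cube: "{u1, v1, u2, v2, u3, v3} \<subseteq> cube m"
    and red: "red u2 \<noteq> red u1" "red u3 \<noteq> red u1" "red v1 \<noteq> red u1" "red v2 = red u1" "red v3 = red u1"
  defines "f \<equiv> \<lambda>i j v. ins d i (ins e j v)"
  shows "link3 (Suc (Suc m)) (f s t u1) (f s' t' v1) (f s' t u2) (f s t' v2) (f s t' u3) (f s' t v3)"
proof -
  have m2: "2 \<le> m" using m(1) by simp
  have "{u3, v2} \<subseteq> cube m" "red u3 \<noteq> red v2" using cube red by auto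
  with m(1) obtain p1 p2 p3 p q c x where P: "joins u3 p1 p" "joins q p2 c" "joins x p3 v2"
      "mset p1 + mset p2 + mset p3 = mset_set (cube m)"
    and Pred: "red p = red v2" "red q = red u3" "red c = red v2" "red x = red u3"
    by (rule split_cube_three)
  have setP: "set p1 \<union> set p2 \<union> set p3 = cube m" using arg_cong[OF P(4), of set_mset] by simp
  have Pcube: "{p, q, c, x} \<subseteq> cube m"
    using setP joins_ends[OF P(1)] joins_ends[OF P(2)] joins_ends[OF P(3)] by auto
  have "mset (p1 @ p2 @ p3) = mset_set (cube m)" using P(4) by (simp add: ac_simps)
  then have "distinct (p1 @ p2 @ p3)" by (rule distinct_if_mset_set) simp
  then have Pne: "p \<noteq> c" "q \<noteq> x"
    using joins_ends[OF P(1)] joins_ends[OF P(2)] joins_ends[OF P(3)] by auto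
  \<comment> \<open>The third path leaves the quarter \<open>s' t'\<close> at \<open>w\<close>, the second path leaves \<open>s' t\<close> at \<open>z\<close>.\<close>
  obtain w where w: "w \<in> cube m" "red w \<longleftrightarrow> \<not> red u1" "w \<notin> set [v1, u2]"
    using fresh_vertex[of "[v1, u2]" m "\<not> red u1"] m(1) by auto
  obtain z where z: "z \<in> cube m" "red z \<longleftrightarrow> red u1" "z \<notin> set [v3, u1]"
    using fresh_vertex[of "[v3, u1]" m "red u1"] m(1) by auto
  have N: "neutral2 m u1 q z x" "neutral2 m c v1 p w" "neutral2 m u2 z w v3"
    using cube red Pcube Pred Pne w z by (auto simp: neutral2_def)
  obtain a1 a2 where A: "joins u1 a1 q" "joins z a2 x" "mset a1 + mset a2 = mset_set (cube m)"
    using link2_obtain[OF m2 N(1)] .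
  obtain b1 b3 where B: "joins c b1 v1" "joins p b3 w" "mset b1 + mset b3 = mset_set (cube m)"
    using link2_obtain[OF m2 N(2)] .
  obtain c2 c3 where C: "joins u2 c2 z" "joins w c3 v3" "mset c2 + mset c3 = mset_set (cube m)"
    using link2_obtain[OF m2 N(3)] .
  have J: "joins (f i j g) (map (f i j) l) (f i j h)" if "joins g l h" for g l h i j
    using joins_ins[OF joins_ins[OF that]] by (simp add: f_def comp_def)
  have adj: "adj (f s t v) (f s' t v)" "adj (f s' t v) (f s t v)"
    "adj (f s t' v) (f s' t' v)" "adj (f s' t' v) (f s' t v)"
    "adj (f s t v) (f s t' v)" for v
    using m(4,5) by (simp_all add: f_def adj_ins adj_ins_across)
  have "joins (f s t u1) (map (f s t) a1 @ map (f s t') p2 @ map (f s' t') b1) (f s' t' v1)"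
    by (rule joins_append[OF J[OF A(1)] adj(5) joins_append[OF J[OF P(2)] adj(3) J[OF B(1)]]])
  moreover have "joins (f s' t u2) (map (f s' t) c2 @ map (f s t) a2 @ map (f s t') p3) (f s t' v2)"
    by (rule joins_append[OF J[OF C(1)] adj(2) joins_append[OF J[OF A(2)] adj(5) J[OF P(3)]]])
  moreover have "joins (f s t' u3) (map (f s t') p1 @ map (f s' t') b3 @ map (f s' t) c3) (f s' t v3)"
    by (rule joins_append[OF J[OF P(1)] adj(3) joins_append[OF J[OF B(2)] adj(4) J[OF C(2)]]])
  moreover have "image_mset (f s t) (mset a1 + mset a2) + image_mset (f s t') (mset p1 + mset p2 + mset p3) +
      (image_mset (f s' t) (mset c2 + mset c3) + image_mset (f s' t') (mset b1 + mset b3)) =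
      mset_set (cube (Suc (Suc m)))"
    unfolding A(3) B(3) C(3) P(4)
    using mset_cube_Suc[OF m(2,4)] mset_cube_Suc[OF m(3,5)]
    by (simp add: f_def image_mset.compositionality comp_def)
  ultimately show ?thesis by (intro link3I) (auto simp: ac_simps)
qed

definition neutral3 :: "nat \<Rightarrow> vertex \<Rightarrow> vertex \<Rightarrow> vertex \<Rightarrow> vertex \<Rightarrow> vertex \<Rightarrow> vertex \<Rightarrow> bool" where
  "neutral3 n a1 b1 a2 b2 a3 b3 \<longleftrightarrow>
    neutral2 n a1 b1 a2 b2 \<and> neutral2 n a1 b1 a3 b3 \<and> neutral2 n a2 b2 a3 b3"

lemma neutral3_swap12: "neutral3 n a1 b1 a2 b2 a3 b3 \<Longrightarrow> neutral3 n a2 b2 a1 b1 a3 b3"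
  by (auto simp: neutral3_def neutral2_def)

lemma neutral3_swap23: "neutral3 n a1 b1 a2 b2 a3 b3 \<Longrightarrow> neutral3 n a1 b1 a3 b3 a2 b2"
  by (auto simp: neutral3_def neutral2_def)

lemma neutral3_rev2: "neutral3 n a1 b1 a2 b2 a3 b3 \<Longrightarrow> neutral3 n a1 b1 b2 a2 a3 b3"
  by (auto simp: neutral3_def neutral2_def)

lemma neutral3_rev3: "neutral3 n a1 b1 a2 b2 a3 b3 \<Longrightarrow> neutral3 n a1 b1 a2 b2 b3 a3"
  by (auto simp: neutral3_def neutral2_def)

lemma neutral3_cube: "neutral3 n a1 b1 a2 b2 a3 b3 \<Longrightarrow> {a1, b1, a2, b2, a3, b3} \<subseteq> cube n"
  by (auto simp: neutral3_def neutral2_def)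

lemma link3_opposite_noncrossing:
  assumes n: "4 \<le> n" "d \<le> n" and conf: "neutral3 (Suc n) a1 b1 a2 b2 a3 b3"
    and sides: "a1 ! d = b1 ! d" "a2 ! d = b2 ! d" "a1 ! d \<noteq> a2 ! d"
  shows "link3 (Suc n) a1 b1 a2 b2 a3 b3"
proof -
  note cube = neutral3_cube[OF conf]
  obtain s t where s: "a1 ! d = s" and t: "a2 ! d = t" by simp
  obtain i j where i: "a3 ! d = i" and j: "b3 ! d = j" by simp
  have st: "s \<noteq> t" "2 \<le> n" "3 \<le> n" "d \<le> n" "a1 ! d = s" "b1 ! d = s" "a2 ! d = t" "b2 ! d = t"
    "a3 ! d = i" "b3 ! d = j" using sides s t i j n by auto
  have sub: "{a1, b1} \<subseteq> cube (Suc n)" "{a2, b2} \<subseteq> cube (Suc n)" "{a3, b3} \<subseteq> cube (Suc n)"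
    using cube by auto
  obtain x1 y1 where 1: "x1 \<in> cube n" "y1 \<in> cube n" "a1 = ins d s x1" "b1 = ins d s y1"
    using ins_pair_exists[of a1 b1 n d s s] sub st by blast
  obtain x2 y2 where 2: "x2 \<in> cube n" "y2 \<in> cube n" "a2 = ins d t x2" "b2 = ins d t y2"
    using ins_pair_exists[of a2 b2 n d t t] sub st by blast
  obtain x3 y3 where 3: "x3 \<in> cube n" "y3 \<in> cube n" "a3 = ins d i x3" "b3 = ins d j y3"
    using ins_pair_exists[of a3 b3 n d i j] sub st by blast
  note [simp] = 1 2 3
  note conf' = conf[unfolded neutral3_def neutral2_def]
  have red: "red x1 \<noteq> red y1" "red x2 \<noteq> red y2" "red x3 = red y3 \<longleftrightarrow> i \<noteq> j"
    using conf' by auto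
  have disj: "i = s \<Longrightarrow> x3 \<notin> {x1, y1}" "i = t \<Longrightarrow> x3 \<notin> {x2, y2}"
    "j = s \<Longrightarrow> y3 \<notin> {x1, y1}" "j = t \<Longrightarrow> y3 \<notin> {x2, y2}"
    using conf' st by auto
  consider "i = s" "j = s" | "i = t" "j = t" | "i = s" "j = t" | "i = t" "j = s" using st by auto
  then show ?thesis
  proof cases
    case 1
    then have "neutral2 n x1 y1 x3 y3" using red disj by (auto simp: neutral2_def)
    then show ?thesis using link3_opposite_sides[of n d s t x2 y2 x1 y1 x3 y3] st red 1 by simp
  next
    case 2
    then have "neutral2 n x2 y2 x3 y3" using red disj by (auto simp: neutral2_def)
    then have "link3 (Suc n) a2 b2 a1 b1 a3 b3"
      using link3_opposite_sides[of n d t s x1 y1 x2 y2 x3 y3] st red 2 by simp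
    then show ?thesis by (rule link3_swap12)
  next
    case 3
    then show ?thesis
      using link3_opposite_sides_crossing[of n d s t x1 y1 x2 y2 x3 y3] st red disj by simp
  next
    case 4
    then have "link3 (Suc n) a1 b1 a2 b2 b3 a3"
      using link3_opposite_sides_crossing[of n d s t x1 y1 x2 y2 y3 x3] st red disj by simp
    then show ?thesis by (rule link3_rev3)
  qed
qed

lemma link3_one_crossing:
  assumes n: "4 \<le> n" "d \<le> n" and conf: "neutral3 (Suc n) a1 b1 a2 b2 a3 b3"
    and sides: "a1 ! d = b1 ! d" "a2 ! d = b2 ! d" "a1 ! d = a2 ! d" "a3 ! d = a1 ! d" "b3 ! d \<noteq> a3 ! d"
  shows "link3 (Suc n) a1 b1 a2 b2 a3 b3"
proof -
  note cube = neutral3_cube[OF conf]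
  obtain s t where s: "a1 ! d = s" and t: "b3 ! d = t" by simp
  have st: "s \<noteq> t" "d \<le> n" "a1 ! d = s" "b1 ! d = s" "a2 ! d = s" "b2 ! d = s" "a3 ! d = s" "b3 ! d = t"
    using sides s t n by auto
  have sub: "{a1, b1} \<subseteq> cube (Suc n)" "{a2, b2} \<subseteq> cube (Suc n)" "{a3, b3} \<subseteq> cube (Suc n)"
    using cube by auto
  obtain x1 y1 where 1: "x1 \<in> cube n" "y1 \<in> cube n" "a1 = ins d s x1" "b1 = ins d s y1"
    using ins_pair_exists[of a1 b1 n d s s] sub st by blast
  obtain x2 y2 where 2: "x2 \<in> cube n" "y2 \<in> cube n" "a2 = ins d s x2" "b2 = ins d s y2"
    using ins_pair_exists[of a2 b2 n d s s] sub st by blast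
  obtain x3 y3 where 3: "x3 \<in> cube n" "y3 \<in> cube n" "a3 = ins d s x3" "b3 = ins d t y3"
    using ins_pair_exists[of a3 b3 n d s t] sub st by blast
  note [simp] = 1 2 3
  note conf' = conf[unfolded neutral3_def neutral2_def]
  have "neutral2 n x1 y1 x2 y2" "red x3 = red y3" "x3 \<notin> {x1, y1, x2, y2}"
    using conf' st by (auto simp: neutral2_def)
  then show ?thesis using link3_two_inside[of n d s t x3 y3 x1 y1 x2 y2] n st by simp
qed

text \<open>When cutting an edge fails, the pairs \<open>a2, b2\<close> and \<open>a3, b3\<close> are edges in direction \<open>d\<close>. Another coordinate
  then puts them into different faces.\<close>

lemma link3_two_crossing:
  assumes n: "4 \<le> n" "d \<le> n" and conf: "neutral3 (Suc n) a1 b1 a2 b2 a3 b3"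
    and sides: "a1 ! d = b1 ! d" "a2 ! d = a1 ! d" "a3 ! d = a1 ! d" "b2 ! d \<noteq> a2 ! d" "b3 ! d \<noteq> a3 ! d"
  shows "link3 (Suc n) a1 b1 a2 b2 a3 b3"
proof -
  note cube = neutral3_cube[OF conf]
  obtain s t where s: "a1 ! d = s" and t: "b3 ! d = t" by simp
  have st: "s \<noteq> t" "d \<le> n" "a1 ! d = s" "b1 ! d = s" "a2 ! d = s" "b2 ! d = t" "a3 ! d = s" "b3 ! d = t"
    using sides s t n by auto
  have sub: "{a1, b1} \<subseteq> cube (Suc n)" "{a2, b2} \<subseteq> cube (Suc n)" "{a3, b3} \<subseteq> cube (Suc n)"
    using cube by auto
  obtain x1 y1 where 1: "x1 \<in> cube n" "y1 \<in> cube n" "a1 = ins d s x1" "b1 = ins d s y1"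
    using ins_pair_exists[of a1 b1 n d s s] sub st by blast
  obtain x2 y2 where 2: "x2 \<in> cube n" "y2 \<in> cube n" "a2 = ins d s x2" "b2 = ins d t y2"
    using ins_pair_exists[of a2 b2 n d s t] sub st by blast
  obtain x3 y3 where 3: "x3 \<in> cube n" "y3 \<in> cube n" "a3 = ins d s x3" "b3 = ins d t y3"
    using ins_pair_exists[of a3 b3 n d s t] sub st by blast
  note conf' = conf[unfolded neutral3_def neutral2_def 1(3,4) 2(3,4) 3(3,4)]
  note [simp] = 1(1,2) 2(1,2) 3(1,2)
  have red: "red x1 \<noteq> red y1" "red x2 = red y2" "red x3 = red y3" 
    and disj: "{x1, y1} \<inter> {x2, x3} = {}" "x2 \<noteq> x3" "y2 \<noteq> y3"
    using conf' st by auto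
  show ?thesis
  proof (cases "red x2 = red x3")
    case True
    then show ?thesis
      using link3_two_crossing_charged[of n d s t x1 y1 x2 x3 y2 y3] n st red disj
      by (simp add: 1 2 3)
  next
    case False
    then have N: "neutral2 n x1 y1 x2 x3" using red disj by (auto simp: neutral2_def)
    show ?thesis
    proof (cases "x2 = y2 \<and> x3 = y3")
      case False
      then show ?thesis
        using link3_two_crossing_neutral[of n d s t y2 y3 x1 y1 x2 x3] N n st red
        by (simp add: 1 2 3)
    next
      case True
      \<comment> \<open>Since \<open>b2\<close> and \<open>b3\<close> differ from \<open>a2\<close> and \<open>a3\<close> in direction \<open>d\<close> only, \<open>e\<close> separates the two pairs.\<close>
      obtain k where k: "n = Suc k" using n by (cases n) auto
      obtain e where e: "e \<le> k" "x2 ! e \<noteq> x3 ! e"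
        using differing_coordinate[of x2 k x3] 2 3 disj k by auto
      let ?e = "skip d e"
      have "e < n" using e k by simp
      then have at_e: "ins d i x2 ! ?e = x2 ! e" "ins d i x3 ! ?e = x3 ! e" for i
        using ins_nth_skip[OF 2(1) st(2)] ins_nth_skip[OF 3(1) st(2)] by blast+
      have "?e \<le> n" using \<open>e < n\<close> by (rule skip_le)
      moreover have "a2 ! ?e = b2 ! ?e" "a3 ! ?e = b3 ! ?e" "a2 ! ?e \<noteq> a3 ! ?e"
        using True e(2) at_e unfolding 2 3 by auto
      moreover have "neutral3 (Suc n) a2 b2 a3 b3 a1 b1"
        by (rule neutral3_swap23[OF neutral3_swap12[OF conf]])
      ultimately have "link3 (Suc n) a2 b2 a3 b3 a1 b1"
        using link3_opposite_noncrossing[OF n(1)] by blast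
      then show ?thesis by (rule link3_swap12[OF link3_swap23])
    qed
  qed
qed

lemma link3_mixed:
  assumes n: "4 \<le> n" "d \<le> n" and conf: "neutral3 (Suc n) a1 b1 a2 b2 a3 b3"
    and sides: "a1 ! d = b1 ! d" "a2 ! d \<noteq> b2 ! d"
  shows "link3 (Suc n) a1 b1 a2 b2 a3 b3"
proof -
  have aux: "link3 (Suc n) a1 b1 a2 b2 a3 b3"
    if conf: "neutral3 (Suc n) a1 b1 a2 b2 a3 b3" and sides: "b2 ! d \<noteq> a2 ! d" "a2 ! d = a1 ! d"
    for a2 b2
  proof -
    consider "a3 ! d = b3 ! d" "a3 ! d = a1 ! d" | "a3 ! d = b3 ! d" "a1 ! d \<noteq> a3 ! d"
      | "a3 ! d \<noteq> b3 ! d" "a3 ! d = a1 ! d" | "a3 ! d \<noteq> b3 ! d" "b3 ! d = a1 ! d" by auto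
    then show ?thesis
    proof cases
      case 1
      then have "link3 (Suc n) a1 b1 a3 b3 a2 b2"
        using link3_one_crossing[OF n neutral3_swap23[OF conf]] \<open>a1 ! d = b1 ! d\<close> sides by auto
      then show ?thesis by (rule link3_swap23)
    next
      case 2
      then have "link3 (Suc n) a1 b1 a3 b3 a2 b2"
        using link3_opposite_noncrossing[OF n neutral3_swap23[OF conf]] \<open>a1 ! d = b1 ! d\<close> by auto
      then show ?thesis by (rule link3_swap23)
    next
      case 3
      then show ?thesis using link3_two_crossing[OF n conf] \<open>a1 ! d = b1 ! d\<close> sides by auto
    next
      case 4
      then have "link3 (Suc n) a1 b1 a2 b2 b3 a3"
        using link3_two_crossing[OF n neutral3_rev3[OF conf]] \<open>a1 ! d = b1 ! d\<close> sides by auto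
      then show ?thesis by (rule link3_rev3)
    qed
  qed
  show ?thesis
  proof (cases "a2 ! d = a1 ! d")
    case True
    then show ?thesis using aux[OF conf] sides by auto
  next
    case False
    then have "link3 (Suc n) a1 b1 b2 a2 a3 b3"
      using aux[OF neutral3_rev2[OF conf]] sides by auto
    then show ?thesis by (rule link3_rev2)
  qed
qed

lemma link3_two_directions:
  assumes m: "3 \<le> m" "d \<le> Suc m" "e \<le> Suc m" "d \<noteq> e"
    and conf: "neutral3 (Suc (Suc m)) a1 b1 a2 b2 a3 b3" "red a2 = red a1" "red a3 = red a1"
    and d: "a2 ! d \<noteq> a1 ! d" "a3 ! d = a1 ! d"
      "b1 ! d \<noteq> a1 ! d" "b2 ! d \<noteq> a2 ! d" "b3 ! d \<noteq> a3 ! d"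
    and e: "a2 ! e = a1 ! e" "a3 ! e \<noteq> a1 ! e"
      "b1 ! e \<noteq> a1 ! e" "b2 ! e \<noteq> a2 ! e" "b3 ! e \<noteq> a3 ! e"
  shows "link3 (Suc (Suc m)) a1 b1 a2 b2 a3 b3"
proof -
  note cube = neutral3_cube[OF conf(1)]
  obtain e' where e': "e' \<le> m" "e = skip d e'" using obtain_skip[OF m(2-4)] .
  obtain s t where s: "a1 ! d = s" and t: "a1 ! e = t" by simp
  obtain s' t' where s': "b1 ! d = s'" and t': "b1 ! e = t'" by simp
  have ne: "s \<noteq> s'" "t \<noteq> t'" using s s' t t' d e by auto
  have at_d: "a2 ! d = s'" "b2 ! d = s" "a3 ! d = s" "b3 ! d = s'" using s s' d by auto
  have at_e: "a2 ! e = t" "b2 ! e = t'" "a3 ! e = t'" "b3 ! e = t" using t t' e by auto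
  note obt = obtain_ins_ins[OF _ m(2) e'(1)]
  obtain u1 where u1: "u1 \<in> cube m" "a1 = ins d s (ins e' t u1)"
    using obt[of a1 s t] cube s t e' by auto
  obtain v1 where v1: "v1 \<in> cube m" "b1 = ins d s' (ins e' t' v1)"
    using obt[of b1 s' t'] cube s' t' e' by auto
  obtain u2 where u2: "u2 \<in> cube m" "a2 = ins d s' (ins e' t u2)"
    using obt[of a2 s' t] cube at_d at_e e' by auto
  obtain v2 where v2: "v2 \<in> cube m" "b2 = ins d s (ins e' t' v2)"
    using obt[of b2 s t'] cube at_d at_e e' by auto
  obtain u3 where u3: "u3 \<in> cube m" "a3 = ins d s (ins e' t' u3)"
    using obt[of a3 s t'] cube at_d at_e e' by auto
  obtain v3 where v3: "v3 \<in> cube m" "b3 = ins d s' (ins e' t v3)"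
    using obt[of b3 s' t] cube at_d at_e e' by auto
  have "red b1 \<noteq> red a1" "red b2 \<noteq> red a1" "red b3 \<noteq> red a1"
    using conf by (auto simp: neutral3_def neutral2_def)
  then have "red u2 \<noteq> red u1" "red u3 \<noteq> red u1" "red v1 \<noteq> red u1" "red v2 = red u1" "red v3 = red u1"
    using conf(2,3) ne unfolding u1 u2 u3 v1 v2 v3 by auto
  then show ?thesis
    using link3_quadrants[OF m(1,2) e'(1) ne, of u1 v1 u2 v2 u3 v3] u1 v1 u2 v2 u3 v3 by simp
qed

text \<open>Some coordinate \<open>d\<close> separates two of \<open>a1, a2, a3\<close>, and some \<open>e\<close> separates the third of them from the one it still
  shares a face with. Both coordinates separate every pair, and up to a permutation of the pairs the
  ends lie in the quarters as required by \<open>link3_quadrants\<close>.\<close>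

lemma link3_uniform:
  assumes n: "4 \<le> n" and conf: "neutral3 (Suc n) a1 b1 a2 b2 a3 b3" "red a2 = red a1" "red a3 = red a1"
    and uniform: "\<And>d. d \<le> n \<Longrightarrow>
      a1 ! d \<noteq> b1 ! d \<and> a2 ! d \<noteq> b2 ! d \<and> a3 ! d \<noteq> b3 ! d \<or> a1 ! d = a2 ! d \<and> a1 ! d = a3 ! d"
  shows "link3 (Suc n) a1 b1 a2 b2 a3 b3"
proof -
  obtain m where m: "n = Suc m" "3 \<le> m" using n by (cases n) auto
  have aux: "link3 (Suc n) a1 b1 a2 b2 a3 b3"
    if conf: "neutral3 (Suc n) a1 b1 a2 b2 a3 b3" "red a2 = red a1" "red a3 = red a1"
      and uniform: "\<And>d. d \<le> n \<Longrightarrow>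
        a1 ! d \<noteq> b1 ! d \<and> a2 ! d \<noteq> b2 ! d \<and> a3 ! d \<noteq> b3 ! d \<or> a1 ! d = a2 ! d \<and> a1 ! d = a3 ! d"
      and d: "d \<le> n" "a1 ! d \<noteq> a2 ! d" "a3 ! d = a1 ! d" for a1 b1 a2 b2 d
  proof -
    have "a1 \<noteq> a3" using conf by (auto simp: neutral3_def neutral2_def)
    then obtain e where e: "e \<le> n" "a1 ! e \<noteq> a3 ! e"
      using differing_coordinate[of a1 n a3] neutral3_cube[OF conf(1)] by auto
    have ud: "a1 ! d \<noteq> b1 ! d \<and> a2 ! d \<noteq> b2 ! d \<and> a3 ! d \<noteq> b3 ! d"
      using uniform[OF d(1)] d(2) by blast
    have ue: "a1 ! e \<noteq> b1 ! e \<and> a2 ! e \<noteq> b2 ! e \<and> a3 ! e \<noteq> b3 ! e"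
      using uniform[OF e(1)] e(2) by blast
    have de: "d \<le> Suc m" "e \<le> Suc m" "d \<noteq> e" using d e m by auto
    show ?thesis
    proof (cases "a2 ! e = a1 ! e")
      case True
      show ?thesis
        unfolding m(1)
        by (rule link3_two_directions[OF m(2) de conf(1)[unfolded m(1)] conf(2,3)])
          (use d ud ue e True in blast)+
    next
      case False
      have perm: "neutral3 (Suc n) a3 b3 a2 b2 a1 b1"
        by (rule neutral3_swap12[OF neutral3_swap23[OF neutral3_swap12[OF conf(1)]]])
      have "link3 (Suc n) a3 b3 a2 b2 a1 b1"
        unfolding m(1)
        by (rule link3_two_directions[OF m(2) de perm[unfolded m(1)]])
          (use conf(2,3) d ud ue e False in blast)+
      then show ?thesis by (rule link3_swap12[OF link3_swap23[OF link3_swap12]])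
    qed
  qed
  have "a1 \<noteq> a2" using conf by (auto simp: neutral3_def neutral2_def)
  then obtain d where d: "d \<le> n" "a1 ! d \<noteq> a2 ! d"
    using differing_coordinate[of a1 n a2] neutral3_cube[OF conf(1)] by auto
  show ?thesis
  proof (cases "a3 ! d = a1 ! d")
    case True
    show ?thesis by (rule aux[OF conf uniform d True])
  next
    case False
    have "link3 (Suc n) a2 b2 a1 b1 a3 b3"
    proof (rule aux)
      show "neutral3 (Suc n) a2 b2 a1 b1 a3 b3" using conf(1) by (rule neutral3_swap12)
      show "a2 ! i \<noteq> b2 ! i \<and> a1 ! i \<noteq> b1 ! i \<and> a3 ! i \<noteq> b3 ! i \<or> a2 ! i = a1 ! i \<and> a2 ! i = a3 ! i"
        if "i \<le> n" for i using uniform[OF that] by auto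
    qed (use conf d False in auto)
    then show ?thesis by (rule link3_swap12)
  qed
qed

theorem link3_cube:
  assumes "5 \<le> n" "neutral3 n a1 b1 a2 b2 a3 b3"
    and red: "red a2 = red a1" "red a3 = red a1"
  shows "link3 n a1 b1 a2 b2 a3 b3"
proof -
  obtain m where n: "n = Suc m" "4 \<le> m" using assms(1) by (cases n) auto
  note conf = assms(2)[unfolded n(1)]
  note perm = conf neutral3_swap12[OF conf] neutral3_swap23[OF conf]
    neutral3_swap12[OF neutral3_swap23[OF conf]] neutral3_swap23[OF neutral3_swap12[OF conf]]
    neutral3_swap12[OF neutral3_swap23[OF neutral3_swap12[OF conf]]]
  have "link3 (Suc m) a1 b1 a2 b2 a3 b3"
  proof (cases "\<forall>d\<le>m. a1 ! d \<noteq> b1 ! d \<and> a2 ! d \<noteq> b2 ! d \<and> a3 ! d \<noteq> b3 ! d \<or>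
      a1 ! d = a2 ! d \<and> a1 ! d = a3 ! d")
    case True
    then show ?thesis by (intro link3_uniform[OF n(2) conf red]) blast
  next
    case False
    then obtain d where d: "d \<le> m"
      "\<not> (a1 ! d \<noteq> b1 ! d \<and> a2 ! d \<noteq> b2 ! d \<and> a3 ! d \<noteq> b3 ! d)"
      "\<not> (a1 ! d = a2 ! d \<and> a1 ! d = a3 ! d)" by blast
    note mix = link3_mixed[OF n(2) d(1)] and opp = link3_opposite_noncrossing[OF n(2) d(1)]
    consider "a1 ! d = b1 ! d" "a2 ! d \<noteq> b2 ! d" | "a1 ! d = b1 ! d" "a3 ! d \<noteq> b3 ! d"
      | "a2 ! d = b2 ! d" "a1 ! d \<noteq> b1 ! d" | "a2 ! d = b2 ! d" "a3 ! d \<noteq> b3 ! d"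
      | "a3 ! d = b3 ! d" "a1 ! d \<noteq> b1 ! d" | "a3 ! d = b3 ! d" "a2 ! d \<noteq> b2 ! d"
      | "a1 ! d = b1 ! d" "a2 ! d = b2 ! d" "a1 ! d \<noteq> a2 ! d"
      | "a1 ! d = b1 ! d" "a3 ! d = b3 ! d" "a1 ! d \<noteq> a3 ! d"
      using d(2,3) by blast
    then show ?thesis
    proof cases
      case 1 show ?thesis by (rule mix[OF perm(1) 1])
    next
      case 2 show ?thesis by (rule link3_swap23[OF mix[OF perm(3) 2]])
    next
      case 3 show ?thesis by (rule link3_swap12[OF mix[OF perm(2) 3]])
    next
      case 4 show ?thesis by (rule link3_swap12[OF link3_swap23[OF mix[OF perm(5) 4]]])
    next
      case 5 show ?thesis by (rule link3_swap23[OF link3_swap12[OF mix[OF perm(4) 5]]])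
    next
      case 6 show ?thesis
        by (rule link3_swap12[OF link3_swap23[OF link3_swap12[OF mix[OF perm(6) 6]]]])
    next
      case 7 show ?thesis by (rule opp[OF perm(1) 7])
    next
      case 8 show ?thesis by (rule link3_swap23[OF opp[OF perm(3) 8]])
    qed
  qed
  then show ?thesis by (simp add: n)
qed

section \<open>The local structure of a path covering\<close>

lemma verts_hypercube [simp]: "verts (hypercube n) = cube n"
  by (simp add: hypercube_def cube_def)

lemma arcs_ends_hypercube: "arcs_ends (hypercube n) = {(u, v). u \<in> cube n \<and> v \<in> cube n \<and> adj u v}"
  unfolding hypercube_def with_proj_simps pair_pre_digraph.select_convs
  using card_differ_eq_1_iff_adj by (auto simp: cube_def)

lemma vwalk_arcs_subset_iff:
  assumes "set p \<subseteq> A"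
  shows "set (vwalk_arcs p) \<subseteq> {(u, v). u \<in> A \<and> v \<in> A \<and> R u v} \<longleftrightarrow> successively R p"
  using assms by (induction p rule: vwalk_arcs.induct) auto

lemma vpath_hypercube_iff:
  "vpath p (hypercube n) \<longleftrightarrow> p \<noteq> [] \<and> set p \<subseteq> cube n \<and> successively adj p \<and> distinct p"
proof (cases "set p \<subseteq> cube n")
  case True
  then show ?thesis
    unfolding vpath_def vwalk_def arcs_ends_hypercube verts_hypercube vwalk_arcs_subset_iff[OF True]
    by blast
next
  case False
  then show ?thesis unfolding vpath_def vwalk_def verts_hypercube by blast
qed

lemma faulty_hypercube_empty: "faulty_hypercube n {} = hypercube n"
proof -
  have "{e \<in> arcs (hypercube n). tail (hypercube n) e \<in> verts (hypercube n) \<and>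
      head (hypercube n) e \<in> verts (hypercube n)} = arcs (hypercube n)"
    by (auto simp: hypercube_def)
  then show ?thesis by (simp add: faulty_hypercube_def induce_subgraph_def)
qed

lemma path_covering_if_link3:
  assumes "link3 n a1 b1 a2 b2 a3 b3"
  obtains p1 p2 p3 where "joins a1 p1 b1" "joins a2 p2 b2" "joins a3 p3 b3"
    "distinct [p1, p2, p3]" "path_covering (hypercube n) {p1, p2, p3}"
proof -
  obtain p1 p2 p3 where p: "joins a1 p1 b1" "joins a2 p2 b2" "joins a3 p3 b3"
    "mset p1 + mset p2 + mset p3 = mset_set (cube n)"
    using assms unfolding link3_def by blast
  have eq: "mset (p1 @ p2 @ p3) = mset_set (cube n)" using p(4) by (simp add: ac_simps)
  then have dist: "distinct (p1 @ p2 @ p3)" by (rule distinct_if_mset_set) simp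
  have cover: "set p1 \<union> set p2 \<union> set p3 = cube n" using arg_cong[OF p(4), of set_mset] by simp
  have ne: "p1 \<noteq> []" "p2 \<noteq> []" "p3 \<noteq> []" using p by (auto simp: joins_def)
  have "distinct [p1, p2, p3]" using dist ne by auto
  moreover have "path_covering (hypercube n) {p1, p2, p3}"
    unfolding path_covering_def vpath_hypercube_iff
    using p(1-3) dist cover by (auto simp: joins_def)
  ultimately show ?thesis using that p by blast
qed


text \<open>The local structure of a covering by paths: \<open>U\<close> relates consecutive vertices on a path and \<open>lab v\<close> is the
  path through \<open>v\<close>. An end has one neighbour, any other vertex has two, all with its own label.
  Impossibility of a covering is derived from these facts alone.\<close>

lemma path_neighbours:
  assumes P: "path_covering (hypercube n) P"
    and ends: "ends ` P = (\<lambda>i. {r i, g i}) ` I"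
    and ne: "\<And>i. i \<in> I \<Longrightarrow> r i \<noteq> g i"
    and disj: "\<And>i j. i \<in> I \<Longrightarrow> j \<in> I \<Longrightarrow> i \<noteq> j \<Longrightarrow> {r i, g i} \<inter> {r j, g j} = {}"
  obtains U and lab :: "vertex \<Rightarrow> vertex list" where
    "\<And>u v. U u v \<Longrightarrow> U v u" "\<And>u v. U u v \<Longrightarrow> adj u v" "\<And>u v. U u v \<Longrightarrow> v \<in> cube n"
    "\<And>u v. U u v \<Longrightarrow> lab u = lab v"
    "\<And>i. i \<in> I \<Longrightarrow> lab (r i) = lab (g i)"
    "\<And>i j. i \<in> I \<Longrightarrow> j \<in> I \<Longrightarrow> i \<noteq> j \<Longrightarrow> lab (r i) \<noteq> lab (r j)"
    "\<And>i v. i \<in> I \<Longrightarrow> v \<in> {r i, g i} \<Longrightarrow> \<exists>!u. U v u"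
    "\<And>v. v \<in> cube n \<Longrightarrow> v \<notin> r ` I \<union> g ` I \<Longrightarrow> \<exists>u u'. u \<noteq> u' \<and> U v u \<and> U v u'"
proof -
  define U where "U u v \<longleftrightarrow> (\<exists>p\<in>P. \<exists>k. Suc k < length p \<and> {u, v} = {p ! k, p ! Suc k})" for u v
  have path: "p \<noteq> []" "set p \<subseteq> cube n" "successively adj p" "distinct p" if "p \<in> P" for p
    using P that unfolding path_covering_def vpath_hypercube_iff by auto
  have same: "p = q" if "p \<in> P" "q \<in> P" "v \<in> set p" "v \<in> set q" for p q v
    using P that unfolding path_covering_def by blast
  have cover: "\<exists>p\<in>P. v \<in> set p" if "v \<in> cube n" for v
    using P that unfolding path_covering_def by auto
  define lab where "lab v = (THE p. p \<in> P \<and> v \<in> set p)" for v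
  have lab: "lab v = p" if "p \<in> P" "v \<in> set p" for v p
    unfolding lab_def using that same by blast
  have end_path: "\<exists>p\<in>P. ends p = {r i, g i}" if "i \<in> I" for i
    using ends that by (metis (no_types, lifting) imageE imageI)
  have end_in: "v \<in> set p" if "p \<in> P" "v \<in> ends p" for p v
    using that path(1) by (auto simp: ends_def)
  have U_sym: "U v u" if "U u v" for u v
    using that unfolding U_def by (metis insert_commute)
  have U_adj: "adj u v" if uv: "U u v" for u v
  proof -
    obtain p k where "p \<in> P" "Suc k < length p" "{u, v} = {p ! k, p ! Suc k}"
      using uv unfolding U_def by blast
    moreover have "adj (p ! k) (p ! Suc k)"
      using path(3)[OF \<open>p \<in> P\<close>] \<open>Suc k < length p\<close> by (simp add: successively_conv_nth)
    ultimately show ?thesis by (auto simp: doubleton_eq_iff intro: adj_sym)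
  qed
  have U_path: "\<exists>p\<in>P. u \<in> set p \<and> v \<in> set p" if "U u v" for u v
    using that unfolding U_def by (auto simp: doubleton_eq_iff intro!: bexI nth_mem)
  have lab_r: "lab (r i) = p" "lab (g i) = p" if "i \<in> I" "p \<in> P" "ends p = {r i, g i}" for i p
    using lab[OF that(2)] end_in[OF that(2)] that(3) by auto
  have distinct_lab: "lab (r i) \<noteq> lab (r j)" if "i \<in> I" "j \<in> I" "i \<noteq> j" for i j
  proof
    assume "lab (r i) = lab (r j)"
    then have "{r i, g i} = {r j, g j}" using end_path lab_r that(1,2) by metis
    then show False using disj[OF that] by auto
  qed
  have unique: "\<exists>!u. U v u" if hyp: "i \<in> I" "v \<in> {r i, g i}" for i v
  proof -
    obtain p where p: "p \<in> P" "ends p = {r i, g i}" using end_path[OF hyp(1)] by blast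
    have "hd p \<noteq> last p" using p(2) ne[OF hyp(1)] by (auto simp: ends_def doubleton_eq_iff)
    then have len: "2 \<le> length p"
      using path(1)[OF p(1)] by (cases p) (auto simp: Suc_le_eq split: if_splits)
    then have bounds: "0 < length p" "length p - 1 < length p" by linarith+
    have vp: "v \<in> set p" "v = p ! 0 \<or> v = p ! (length p - 1)"
      using end_in[OF p(1)] hyp(2) p(2) path(1)[OF p(1)]
      by (auto simp: ends_def hd_conv_nth last_conv_nth)
    have U_iff: "U v u \<longleftrightarrow> (\<exists>k. Suc k < length p \<and> {v, u} = {p ! k, p ! Suc k})" for u
    proof
      assume "U v u"
      then obtain q k where q: "q \<in> P" "Suc k < length q" "{v, u} = {q ! k, q ! Suc k}"
        unfolding U_def by blast
      then have "v \<in> set q" by (auto simp: doubleton_eq_iff)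
      then have "q = p" using same[OF q(1) p(1)] vp by blast
      then show "\<exists>k. Suc k < length p \<and> {v, u} = {p ! k, p ! Suc k}" using q by blast
    qed (use p(1) U_def in blast)
    show ?thesis
    proof (cases "v = p ! 0")
      case True
      have "U v u \<longleftrightarrow> u = p ! 1" for u
      proof
        assume "U v u"
        then obtain k where "Suc k < length p" "{p ! 0, u} = {p ! k, p ! Suc k}"
          unfolding U_iff unfolding True by blast
        moreover have "p ! 0 = p ! l \<longleftrightarrow> l = 0" if "l < length p" for l
          using nth_eq_iff_index_eq[OF path(4)[OF p(1)] bounds(1) that] by auto
        ultimately show "u = p ! 1" by (auto simp: doubleton_eq_iff)
      next
        assume "u = p ! 1"
        then show "U v u" unfolding U_iff using True len by (intro exI[of _ 0]) auto
      qed
      then show ?thesis by simp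
    next
      case False
      then have last: "v = p ! (length p - 1)" using vp by blast
      have "U v u \<longleftrightarrow> u = p ! (length p - 2)" for u
      proof
        assume "U v u"
        then obtain k where "Suc k < length p" "{p ! (length p - 1), u} = {p ! k, p ! Suc k}"
          unfolding U_iff unfolding last by blast
        moreover have "p ! (length p - 1) = p ! l \<longleftrightarrow> l = length p - 1" if "l < length p" for l
          using nth_eq_iff_index_eq[OF path(4)[OF p(1)] bounds(2) that] by auto
        ultimately have "u = p ! k" "Suc k = length p - 1" by (auto simp: doubleton_eq_iff)
        then have "k = length p - 2" by simp
        then show "u = p ! (length p - 2)" using \<open>u = p ! k\<close> by simp
      next
        assume "u = p ! (length p - 2)"
        then show "U v u"
          unfolding U_iff using last len Suc_diff_Suc[of 1 "length p"]
          by (intro exI[of _ "length p - 2"]) (auto simp: numeral_2_eq_2)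
      qed
      then show ?thesis by simp
    qed
  qed
  have two: "\<exists>u u'. u \<noteq> u' \<and> U v u \<and> U v u'" if v: "v \<in> cube n" "v \<notin> r ` I \<union> g ` I" for v
  proof -
    obtain p where p: "p \<in> P" "v \<in> set p" using cover v(1) by blast
    then obtain k where k: "k < length p" "v = p ! k" by (metis in_set_conv_nth)
    have "ends p \<in> (\<lambda>i. {r i, g i}) ` I" using ends p(1) by blast
    then have "v \<noteq> hd p" "v \<noteq> last p" using v(2) by (auto simp: ends_def doubleton_eq_iff)
    moreover have "hd p = p ! 0" "last p = p ! (length p - 1)"
      using path(1)[OF p(1)] by (simp_all add: hd_conv_nth last_conv_nth)
    ultimately have "k \<noteq> 0" "k \<noteq> length p - 1" using k(2) by metis+
    then have kk: "k - 1 < length p" "Suc (k - 1) = k" "Suc k < length p" using k by auto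
    have "{v, p ! (k - 1)} = {p ! (k - 1), p ! Suc (k - 1)}" unfolding kk(2) k(2) by blast
    then have "U v (p ! (k - 1))" unfolding U_def using p(1) k(1) kk(2) by metis
    moreover have "U v (p ! Suc k)" unfolding U_def k(2) using p(1) kk(3) by blast
    moreover have "p ! (k - 1) \<noteq> p ! Suc k"
      using path(4)[OF p(1)] kk by (simp add: nth_eq_iff_index_eq)
    ultimately show ?thesis by blast
  qed
  have U_cube: "v \<in> cube n" if "U u v" for u v using U_path[OF that] path(2) by blast
  have U_lab: "lab u = lab v" if "U u v" for u v
    using U_path[OF that] lab by metis
  have lab_ends: "lab (r i) = lab (g i)" if "i \<in> I" for i
    using end_path[OF that] lab_r[OF that] by metis
  show ?thesis
    by (rule that[of U lab, OF U_sym U_adj U_cube U_lab lab_ends distinct_lab unique two])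
qed

section \<open>Antipodal pairs in a three-dimensional cube\<close>

text \<open>The red vertices of \<open>Q\<^sub>3\<close>. Index 0 is the one that is not an end, so that the ends have the indices
  1, 2, 3.\<close>

definition corner :: "nat \<Rightarrow> vertex" where
  "corner i = [[True, True, False], [False, False, False], [False, True, True], [True, False, True]] ! i"

definition antipode :: "nat \<Rightarrow> vertex" where
  "antipode i = map Not (corner i)"

lemma corner_simps:
  "corner 0 = [True, True, False]" "corner (Suc 0) = [False, False, False]"
  "corner 2 = [False, True, True]" "corner 3 = [True, False, True]"
  "antipode 0 = [False, False, True]" "antipode (Suc 0) = [True, True, True]"
  "antipode 2 = [True, False, False]" "antipode 3 = [False, True, False]"
  by (simp_all add: corner_def antipode_def)

lemma less_4_cases: "(i :: nat) < 4 \<longleftrightarrow> i = 0 \<or> i = 1 \<or> i = 2 \<or> i = 3"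
  by auto

lemma ex_less_4: "(\<exists>i<4. Q i) \<longleftrightarrow> Q 0 \<or> Q 1 \<or> Q 2 \<or> Q (3 :: nat)"
  unfolding less_4_cases by blast

text \<open>Two vertices of \<open>Q\<^sub>3\<close> of opposite colours are adjacent unless they are antipodes.\<close>

lemma adj_corner:
  assumes "i < 4" "adj (corner i) v"
  shows "\<exists>j<4. j \<noteq> i \<and> v = antipode j"
proof -
  have "length v = 3" using adj_length[OF assms(2)] assms(1)
    by (auto simp: less_4_cases corner_simps)
  then have "\<exists>x y z. v = [x, y, z]"
    unfolding numeral_3_eq_3 length_Suc_conv by blast
  then obtain x y z where v: "v = [x, y, z]" by (elim exE) (rule that)
  from assms(1)[unfolded less_4_cases] show ?thesis
  proof (elim disjE)
    assume "i = 0"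
    then show ?thesis using assms(2) unfolding v ex_less_4 by (cases x; cases y; cases z) (simp_all add: corner_simps)
  next
    assume "i = 1"
    then show ?thesis using assms(2) unfolding v ex_less_4 by (cases x; cases y; cases z) (simp_all add: corner_simps)
  next
    assume "i = 2"
    then show ?thesis using assms(2) unfolding v ex_less_4 by (cases x; cases y; cases z) (simp_all add: corner_simps)
  next
    assume "i = 3"
    then show ?thesis using assms(2) unfolding v ex_less_4 by (cases x; cases y; cases z) (simp_all add: corner_simps)
  qed
qed

lemma corner_antipode_mem:
  assumes "i < 4"
  shows "corner i \<in> cube 3" "antipode i \<in> cube 3" "red (corner i)" "green (antipode i)"
  using assms unfolding less_4_cases
  by (elim disjE; simp add: corner_simps cube_def red_def)+

lemma corner_antipode_eq:
  assumes "i < 4" "j < 4"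
  shows "corner i = corner j \<longleftrightarrow> i = j" "antipode i = antipode j \<longleftrightarrow> i = j" "corner i \<noteq> antipode j"
  using assms unfolding less_4_cases by (elim disjE; simp add: corner_simps)+

lemmas corner_antipode = corner_antipode_mem corner_antipode_eq

lemma adj_map_Not: "adj u v \<Longrightarrow> adj (map Not u) (map Not v)"
  unfolding adj_def by (metis list.simps(9) map_append)

lemma adj_antipode:
  assumes "i < 4" "adj (antipode i) v"
  shows "\<exists>j<4. j \<noteq> i \<and> v = corner j"
proof -
  have Not_Not: "map Not (map Not w) = w" for w by (simp add: comp_def)
  have "adj (corner i) (map Not v)"
    using adj_map_Not[OF assms(2)] Not_Not by (simp add: antipode_def)
  then obtain j where "j < 4" "j \<noteq> i" "map Not v = map Not (corner j)"
    using adj_corner[OF assms(1)] unfolding antipode_def by blast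
  then show ?thesis using Not_Not by metis
qed

lemma atLeastAtMost_1_3: "{1..3 :: nat} = {1, 2, 3}"
  by auto

text \<open>The neighbours of \<open>corner 0\<close> are the three green ends, which lie on three different paths.\<close>

lemma no_covering_3:
  assumes P: "path_covering (hypercube 3) P"
    and ends: "ends ` P = (\<lambda>i. {corner i, antipode i}) ` {1..3}"
  shows False
proof -
  note ca = corner_antipode corner_antipode_eq(3)[symmetric]
  obtain U and lab :: "vertex \<Rightarrow> vertex list" where
    U: "\<And>u v. U u v \<Longrightarrow> U v u" "\<And>u v. U u v \<Longrightarrow> adj u v" "\<And>u v. U u v \<Longrightarrow> v \<in> cube 3"
    "\<And>u v. U u v \<Longrightarrow> lab u = lab v"
    and lab: "\<And>i. i \<in> {1..3} \<Longrightarrow> lab (corner i) = lab (antipode i)"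
    "\<And>i j. i \<in> {1..3} \<Longrightarrow> j \<in> {1..3} \<Longrightarrow> i \<noteq> j \<Longrightarrow> lab (corner i) \<noteq> lab (corner j)"
    and ends: "\<And>i v. i \<in> {1..3} \<Longrightarrow> v \<in> {corner i, antipode i} \<Longrightarrow> \<exists>!u. U v u"
    and inner: "\<And>v. v \<in> cube 3 \<Longrightarrow> v \<notin> corner ` {1..3} \<union> antipode ` {1..3} \<Longrightarrow>
      \<exists>u u'. u \<noteq> u' \<and> U v u \<and> U v u'"
    by (rule path_neighbours[OF P ends]) (use ca in auto)
  have "corner 0 \<notin> corner ` {1..3} \<union> antipode ` {1..3}" using ca by auto
  then obtain u u' where u: "u \<noteq> u'" "U (corner 0) u" "U (corner 0) u'"
    using inner[of "corner 0"] ca by auto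
  obtain i where i: "i < 4" "i \<noteq> 0" "u = antipode i" using adj_corner[of 0 u] U(2) u by auto
  obtain j where j: "j < 4" "j \<noteq> 0" "u' = antipode j" using adj_corner[of 0 u'] U(2) u by auto
  have "i \<in> {1..3}" "j \<in> {1..3}" "i \<noteq> j" using i j u(1) by auto
  then have "lab u \<noteq> lab u'" using lab i j by metis
  then show False using U(4)[OF u(2)] U(4)[OF u(3)] by simp
qed

text \<open>Let \<open>r, g\<close> be the vertices of the face containing the ends and \<open>R, G\<close> those above them. Two neighbours of
  \<open>r 0\<close> with equal labels can only be \<open>R 0\<close> and one \<open>g i\<close>; likewise \<open>g 0\<close> is next to \<open>G 0\<close> and one \<open>r j\<close>. Since
  adjacent ends within the face have different labels, all other ends are next to the vertices
  above them, which thereby get their labels. The neighbours of \<open>R i\<close> are now \<open>r i\<close>, \<open>G 0\<close> and those \<open>G k\<close>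
  with \<open>k \<noteq> i\<close>. If \<open>i = j\<close> then \<open>r i\<close> is not available and the others have three different labels; if
  \<open>i \<noteq> j\<close> then \<open>R i\<close> has the label of \<open>r i\<close>, and no other neighbour has it.\<close>

lemma no_covering_4:
  assumes P: "path_covering (hypercube 4) P"
    and ends: "ends ` P = (\<lambda>i. {False # corner i, False # antipode i}) ` {1..3}"
  shows False
proof -
  note ca = corner_antipode corner_antipode_eq(3)[symmetric]
  have cube4: "b # v \<in> cube 4 \<longleftrightarrow> v \<in> cube 3" for b v by (auto simp: cube_def)
  define r g R G where "r i = False # corner i" and "g i = False # antipode i"
    and "R i = True # corner i" and "G i = True # antipode i" for i
  note defs = r_def g_def R_def G_def
  obtain U and lab :: "vertex \<Rightarrow> vertex list" where
    U: "\<And>u v. U u v \<Longrightarrow> U v u" "\<And>u v. U u v \<Longrightarrow> adj u v" "\<And>u v. U u v \<Longrightarrow> v \<in> cube 4"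
    "\<And>u v. U u v \<Longrightarrow> lab u = lab v"
    and lab: "\<And>i. i \<in> {1..3} \<Longrightarrow> lab (r i) = lab (g i)"
    "\<And>i j. i \<in> {1..3} \<Longrightarrow> j \<in> {1..3} \<Longrightarrow> i \<noteq> j \<Longrightarrow> lab (r i) \<noteq> lab (r j)"
    and ends: "\<And>i v. i \<in> {1..3} \<Longrightarrow> v \<in> {r i, g i} \<Longrightarrow> \<exists>!u. U v u"
    and inner: "\<And>v. v \<in> cube 4 \<Longrightarrow> v \<notin> r ` {1..3} \<union> g ` {1..3} \<Longrightarrow>
      \<exists>u u'. u \<noteq> u' \<and> U v u \<and> U v u'"
    by (rule path_neighbours[OF P, of r g "{1..3}"]) (use ca ends in \<open>auto simp: defs\<close>)
  have range_4: "j = 0 \<or> j \<in> {1..3}" if "j < 4" for j :: nat using that by auto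
  have nbr: "U v u \<Longrightarrow> \<exists>b x. u = b # x \<and> x \<in> cube 3" for u v
    using U(3)[of v u] by (auto simp: cube_def length_Suc_conv eval_nat_numeral)
  have U_r: "u = R i \<or> (\<exists>j<4. j \<noteq> i \<and> u = g j)" if "U (r i) u" "i < 4" for i u
    using nbr[OF that(1)] U(2)[OF that(1)]
    by (auto simp: defs split: if_splits dest!: adj_corner[OF that(2)])
  have U_g: "u = G i \<or> (\<exists>j<4. j \<noteq> i \<and> u = r j)" if "U (g i) u" "i < 4" for i u
    using nbr[OF that(1)] U(2)[OF that(1)]
    by (auto simp: defs split: if_splits dest!: adj_antipode[OF that(2)])
  have U_R: "u = r i \<or> (\<exists>j<4. j \<noteq> i \<and> u = G j)" if "U (R i) u" "i < 4" for i u
    using nbr[OF that(1)] U(2)[OF that(1)]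
    by (auto simp: defs split: if_splits dest!: adj_corner[OF that(2)])
  have lab_g: "lab (g i) \<noteq> lab (g j)" if "i \<in> {1..3}" "j \<in> {1..3}" "i \<noteq> j" for i j
    using lab that by metis
  have "\<exists>i\<in>{1..3}. lab (R 0) = lab (r i) \<and> U (r 0) (g i)"
  proof -
    have "r 0 \<in> cube 4" "r 0 \<notin> r ` {1..3} \<union> g ` {1..3}" using ca by (auto simp: defs cube4)
    then obtain u u' where u: "u \<noteq> u'" "U (r 0) u" "U (r 0) u'" using inner by blast
    have *: "w = R 0 \<or> (\<exists>j\<in>{1..3}. w = g j)" if "U (r 0) w" for w
      using U_r[OF that] by fastforce
    have "lab u = lab u'" using U(4)[OF u(2)] U(4)[OF u(3)] by simp
    then show ?thesis using *[OF u(2)] *[OF u(3)] u lab lab_g by metis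
  qed
  then obtain i where i: "i \<in> {1..3}" "lab (R 0) = lab (r i)" "U (r 0) (g i)" by blast
  have "\<exists>j\<in>{1..3}. lab (G 0) = lab (r j) \<and> U (g 0) (r j)"
  proof -
    have "g 0 \<in> cube 4" "g 0 \<notin> r ` {1..3} \<union> g ` {1..3}" using ca by (auto simp: defs cube4)
    then obtain u u' where u: "u \<noteq> u'" "U (g 0) u" "U (g 0) u'" using inner by blast
    have *: "w = G 0 \<or> (\<exists>j\<in>{1..3}. w = r j)" if "U (g 0) w" for w
      using U_g[OF that] by fastforce
    have "lab u = lab u'" using U(4)[OF u(2)] U(4)[OF u(3)] by simp
    then show ?thesis using *[OF u(2)] *[OF u(3)] u lab by metis
  qed
  then obtain j where j: "j \<in> {1..3}" "lab (G 0) = lab (r j)" "U (g 0) (r j)" by blast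
  have up: "lab (G k) = lab (r k)" if k: "k \<in> {1..3}" "k \<noteq> i" for k
  proof -
    obtain u where u: "U (g k) u" using ends[of k "g k"] k by blast
    have "k < 4" using k by auto
    then consider "u = G k" | "u = r 0" | l where "l \<in> {1..3}" "l \<noteq> k" "u = r l"
      using U_g[OF u] range_4 by blast
    then show ?thesis
    proof cases
      case 1
      then show ?thesis using U(4)[OF u] lab k by simp
    next
      case 2
      then show ?thesis using U(4)[OF u] U(4)[OF i(3)] lab_g[of k i] i k by simp
    next
      case 3
      then show ?thesis using U(4)[OF u] lab k by metis
    qed
  qed
  have up': "lab (R k) = lab (r k)" if k: "k \<in> {1..3}" "k \<noteq> j" for k
  proof -
    obtain u where u: "U (r k) u" using ends[of k "r k"] k by blast
    have "k < 4" using k by auto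
    then consider "u = R k" | "u = g 0" | l where "l \<in> {1..3}" "l \<noteq> k" "u = g l"
      using U_r[OF u] range_4 by blast
    then show ?thesis
    proof cases
      case 1
      then show ?thesis using U(4)[OF u] by simp
    next
      case 2
      then show ?thesis using U(4)[OF u] U(4)[OF j(3)] lab(2)[of k j] j k by simp
    next
      case 3
      then show ?thesis using U(4)[OF u] lab k by metis
    qed
  qed
  have "R i \<in> cube 4" "R i \<notin> r ` {1..3} \<union> g ` {1..3}" using ca i(1) by (auto simp: defs cube4)
  then obtain u u' where u: "u \<noteq> u'" "U (R i) u" "U (R i) u'" using inner by blast
  have same: "lab u = lab u'" using U(4)[OF u(2)] U(4)[OF u(3)] by simp
  have nbr_R: "w = r i \<and> i \<noteq> j \<or> w = G 0 \<or> (\<exists>k\<in>{1..3}. k \<noteq> i \<and> w = G k)" if w: "U (R i) w" for w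
  proof -
    have "i < 4" using i(1) by auto
    then have "w = r i \<or> w = G 0 \<or> (\<exists>k\<in>{1..3}. k \<noteq> i \<and> w = G k)" using U_R[OF w] range_4 by blast
    moreover have "i \<noteq> j" if "w = r i"
    proof
      assume "i = j"
      then have "U (r i) (g 0)" "U (r i) (R i)" using U(1) j(3) w that by auto
      then have "g 0 = R i" using ends[of i "r i"] i(1) by blast
      then show False by (simp add: defs)
    qed
    ultimately show ?thesis by blast
  qed
  show False
  proof (cases "i = j")
    case True
    then show False
      using nbr_R[OF u(2)] nbr_R[OF u(3)] same u(1) up lab(2) i(1) j(2) by metis
  next
    case False
    have "w = r i" if w: "U (R i) w" for w
    proof -
      have "lab w = lab (r i)" using U(4)[OF w] up'[OF i(1) False] by simp
      then show ?thesis using nbr_R[OF w] up lab(2) i(1) j(1,2) False by metis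
    qed
    then show False using u by blast
  qed
qed

section \<open>Freely prescribable ends\<close>

lemma neutral_pair_iff: "neutral_pair e \<longleftrightarrow> (\<exists>u v. e = {u, v} \<and> red u \<and> green v)"
  unfolding neutral_pair_def by (metis doubleton_eq_iff)

lemma neutral_pairI: "red u \<noteq> red v \<Longrightarrow> neutral_pair {u, v}"
  unfolding neutral_pair_def by blast

lemma not_charged_if_neutral: "neutral_pair e \<Longrightarrow> \<not> charged_pair e"
  by (auto simp: neutral_pair_def charged_pair_def doubleton_eq_iff)

lemma neutral_or_charged: "card e = 2 \<Longrightarrow> neutral_pair e \<or> charged_pair e"
  unfolding neutral_pair_def charged_pair_def card_2_iff by blast

lemma prescribable_three_neutral:
  assumes conf: "neutral3 n a1 b1 a2 b2 a3 b3"
  shows "prescribable n {} 3 0 {{a1, b1}, {a2, b2}, {a3, b3}}"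
proof -
  let ?E = "{{a1, b1}, {a2, b2}, {a3, b3}}"
  note conf' = conf[unfolded neutral3_def neutral2_def]
  have neutral: "neutral_pair e" if "e \<in> ?E" for e
    using that conf' neutral_pairI by (elim insertE emptyE) simp_all
  then have not_charged: "\<not> charged_pair e" if "e \<in> ?E" for e
    using that not_charged_if_neutral by blast
  have sets: "{e \<in> ?E. green_pair e} = {}" "{e \<in> ?E. red_pair e} = {}"
    "{e \<in> ?E. charged_pair e} = {}" "{e \<in> ?E. neutral_pair e} = ?E"
    using not_charged neutral unfolding green_pair_def red_pair_def by blast+
  have "card ?E = 3" using conf' by (auto simp: card_insert_if doubleton_eq_iff)
  moreover have "disjoint_pairs ?E" using conf' unfolding disjoint_pairs_def by (auto simp: card_insert_if)
  moreover have "\<Union> ?E \<subseteq> cube n" using conf' by auto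
  ultimately show ?thesis
    unfolding prescribable_def in_balance_def faulty_hypercube_empty sets
    by (simp add: red_excess_def)
qed

text \<open>Every pair is neutral or charged and none is charged, so three neutral pairs are all there is.\<close>

lemma three_neutral_if_prescribable:
  assumes "prescribable n {} 3 0 E"
  obtains a1 b1 a2 b2 a3 b3 where "E = {{a1, b1}, {a2, b2}, {a3, b3}}"
    "neutral3 n a1 b1 a2 b2 a3 b3" "red a1" "red a2" "red a3"
proof -
  have E: "disjoint_pairs E" "\<Union> E \<subseteq> cube n" "card {e \<in> E. neutral_pair e} = 3"
    "card {e \<in> E. charged_pair e} = 0"
    using assms by (auto simp: prescribable_def in_balance_def faulty_hypercube_empty)
  have "E \<subseteq> Pow (cube n)" using E(2) by blast
  then have "finite E" by (rule finite_subset) simp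
  then have "\<not> charged_pair e" if "e \<in> E" for e using E(4) that by auto
  then have neutral: "neutral_pair e" if "e \<in> E" for e
    using E(1) that neutral_or_charged unfolding disjoint_pairs_def by blast
  then have "{e \<in> E. neutral_pair e} = E" by blast
  then have "card E = 3" using E(3) by simp
  then obtain e1 e2 e3 where e: "E = {e1, e2, e3}" "e1 \<noteq> e2" "e2 \<noteq> e3" "e1 \<noteq> e3"
    by (auto simp: card_3_iff)
  obtain a1 b1 where 1: "e1 = {a1, b1}" "red a1" "green b1"
    using neutral[of e1] e(1) neutral_pair_iff by blast
  obtain a2 b2 where 2: "e2 = {a2, b2}" "red a2" "green b2"
    using neutral[of e2] e(1) neutral_pair_iff by blast
  obtain a3 b3 where 3: "e3 = {a3, b3}" "red a3" "green b3"
    using neutral[of e3] e(1) neutral_pair_iff by blast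
  have "e1 \<inter> e2 = {}" "e1 \<inter> e3 = {}" "e2 \<inter> e3 = {}"
    using E(1) e unfolding disjoint_pairs_def by blast+
  then have "neutral3 n a1 b1 a2 b2 a3 b3"
    using E(2) 1 2 3 e(1) unfolding neutral3_def neutral2_def by auto
  then show ?thesis using that e(1) 1 2 3 by blast
qed

lemma neutral3_exists:
  assumes "3 \<le> n"
  obtains a1 b1 a2 b2 a3 b3 where "neutral3 n a1 b1 a2 b2 a3 b3"
proof -
  have "\<exists>w1 w2 w3. {w1, w2, w3} \<subseteq> cube n \<and> red w1 = c \<and> red w2 = c \<and> red w3 = c \<and> distinct [w1, w2, w3]"
    for c
  proof -
    obtain w1 where w1: "w1 \<in> cube n" "red w1 \<longleftrightarrow> c"
      using fresh_vertex[of "[]" n c] assms by auto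
    obtain w2 where w2: "w2 \<in> cube n" "red w2 \<longleftrightarrow> c" "w2 \<notin> set [w1]"
      using fresh_vertex[of "[w1]" n c] assms by auto
    obtain w3 where w3: "w3 \<in> cube n" "red w3 \<longleftrightarrow> c" "w3 \<notin> set [w1, w2]"
      using fresh_vertex[of "[w1, w2]" n c] assms by auto
    show ?thesis using w1 w2 w3 by (intro exI[of _ w1] exI[of _ w2] exI[of _ w3]) auto
  qed
  from this[of True] this[of False] obtain a1 a2 a3 b1 b2 b3 where
    "{a1, a2, a3} \<subseteq> cube n \<and> red a1 = True \<and> red a2 = True \<and> red a3 = True \<and> distinct [a1, a2, a3]"
    "{b1, b2, b3} \<subseteq> cube n \<and> red b1 = False \<and> red b2 = False \<and> red b3 = False \<and> distinct [b1, b2, b3]"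
    by (elim exE)
  then have "neutral3 n a1 b1 a2 b2 a3 b3" by (auto simp: neutral3_def neutral2_def)
  then show ?thesis by (rule that)
qed

lemma freely_prescribe_three:
  assumes "5 \<le> n"
  shows "freely_prescribe_ends n {} 3 0"
  unfolding freely_prescribe_ends_def
proof (intro conjI allI impI)
  have "3 \<le> n" using assms by simp
  then obtain a1 b1 a2 b2 a3 b3 where "neutral3 n a1 b1 a2 b2 a3 b3" by (rule neutral3_exists)
  then show "\<exists>E. prescribable n {} 3 0 E" using prescribable_three_neutral by blast
next
  fix E assume "prescribable n {} 3 0 E"
  then obtain a1 b1 a2 b2 a3 b3 where E: "E = {{a1, b1}, {a2, b2}, {a3, b3}}"
    and conf: "neutral3 n a1 b1 a2 b2 a3 b3" and red: "red a1" "red a2" "red a3"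
    by (rule three_neutral_if_prescribable)
  have "link3 n a1 b1 a2 b2 a3 b3" using link3_cube[OF assms conf] red by simp
  then obtain p1 p2 p3 where p: "joins a1 p1 b1" "joins a2 p2 b2" "joins a3 p3 b3"
    "distinct [p1, p2, p3]" "path_covering (hypercube n) {p1, p2, p3}"
    by (rule path_covering_if_link3)
  then have "ends ` {p1, p2, p3} = E" by (simp add: E ends_def joins_def)
  then show "\<exists>P. path_covering (faulty_hypercube n {}) P \<and> ends ` P = E"
    using p(5) faulty_hypercube_empty by metis
qed

lemma three_paths_exist:
  fixes r g :: "nat \<Rightarrow> vertex"
  assumes "5 \<le> n" "\<forall>i\<in>{1..3}. r i \<in> cube n \<and> red (r i)" "inj_on r {1..3}"
    "\<forall>i\<in>{1..3}. g i \<in> cube n \<and> green (g i)" "inj_on g {1..3}"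
  shows "\<exists>\<gamma> :: nat \<Rightarrow> vertex list. k_path_covering 3 (hypercube n) (\<gamma> ` {1..3}) \<and>
    (\<forall>i\<in>{1..3}. connects (\<gamma> i) (r i) (g i))"
proof -
  have r: "r i \<in> cube n" "red (r i)" and g: "g i \<in> cube n" "green (g i)" if "i \<in> {1, 2, 3}" for i
    using assms(2,4) that unfolding atLeastAtMost_1_3 by blast+
  then have rg: "r i \<noteq> g j" if "i \<in> {1, 2, 3}" "j \<in> {1, 2, 3}" for i j using that by metis
  have ne: "r 1 \<noteq> r 2" "r 1 \<noteq> r 3" "r 2 \<noteq> r 3" "g 1 \<noteq> g 2" "g 1 \<noteq> g 3" "g 2 \<noteq> g 3"
    by (simp_all add: inj_on_eq_iff[OF assms(3)] inj_on_eq_iff[OF assms(5)])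
  have "neutral3 n (r 1) (g 1) (r 2) (g 2) (r 3) (g 3)"
    using r g by (simp add: neutral3_def neutral2_def ne ne[symmetric] rg rg[symmetric] del: One_nat_def)
  moreover have "red (r 2) = red (r 1)" "red (r 3) = red (r 1)" using assms(2) by simp_all
  ultimately have "link3 n (r 1) (g 1) (r 2) (g 2) (r 3) (g 3)"
    by (rule link3_cube[OF assms(1)])
  then obtain p1 p2 p3 where p: "joins (r 1) p1 (g 1)" "joins (r 2) p2 (g 2)" "joins (r 3) p3 (g 3)"
    "distinct [p1, p2, p3]" "path_covering (hypercube n) {p1, p2, p3}"
    by (rule path_covering_if_link3)
  define \<gamma> :: "nat \<Rightarrow> vertex list" where "\<gamma> i = (if i = 1 then p1 else if i = 2 then p2 else p3)" for i
  have "\<gamma> ` {1..3} = {p1, p2, p3}" unfolding atLeastAtMost_1_3 by (auto simp: \<gamma>_def)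
  then have "k_path_covering 3 (hypercube n) (\<gamma> ` {1..3})"
    using p(4,5) by (simp add: k_path_covering_def)
  moreover have "\<forall>i\<in>{1..3}. connects (\<gamma> i) (r i) (g i)"
    using p(1-3) unfolding atLeastAtMost_1_3 by (simp add: \<gamma>_def connects_def joins_def)
  ultimately show ?thesis by blast
qed

lemma ends_connecting:
  assumes "\<forall>i\<in>I. connects (\<gamma> i) (r i) (g i)"
  shows "ends ` \<gamma> ` I = (\<lambda>i. {r i, g i}) ` I"
  using assms by (auto simp: ends_def connects_def image_image intro!: image_cong)

lemma mem_A_set_three_neutral:
  "m \<in> A_set 0 0 3 0 \<longleftrightarrow> log 2 6 \<le> real m \<and> (\<forall>n\<ge>m. freely_prescribe_ends n {} 3 0)"
proof -
  have "fault n F \<and> mass F = 0 \<and> charge F = 0 \<longleftrightarrow> F = {}" for n F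
  proof
    assume *: "fault n F \<and> mass F = 0 \<and> charge F = 0"
    then have "finite F" unfolding fault_def verts_hypercube using finite_subset finite_cube by blast
    then show "F = {}" using * by (simp add: mass_def)
  qed (simp add: fault_def mass_def charge_def red_excess_def)
  then show ?thesis by (simp add: A_set_def)
qed

lemma not_freely_prescribe_4: "\<not> freely_prescribe_ends 4 {} 3 0"
proof
  assume free: "freely_prescribe_ends 4 {} 3 0"
  let ?r = "\<lambda>i. False # corner i" and ?g = "\<lambda>i. False # antipode i"
  have "neutral3 4 (?r 1) (?g 1) (?r 2) (?g 2) (?r 3) (?g 3)"
    by (simp add: neutral3_def neutral2_def corner_simps cube_def red_def)
  then have "prescribable 4 {} 3 0 {{?r 1, ?g 1}, {?r 2, ?g 2}, {?r 3, ?g 3}}"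
    by (rule prescribable_three_neutral)
  then obtain P where P: "path_covering (hypercube 4) P"
    "ends ` P = {{?r 1, ?g 1}, {?r 2, ?g 2}, {?r 3, ?g 3}}"
    using free unfolding freely_prescribe_ends_def faulty_hypercube_empty by blast
  have "ends ` P = (\<lambda>i. {?r i, ?g i}) ` {1..3}"
    unfolding P(2) atLeastAtMost_1_3 by simp
  then show False by (rule no_covering_4[OF P(1)])
qed

lemma A_set_three_neutral: "m \<in> A_set 0 0 3 0 \<longleftrightarrow> 5 \<le> m"
proof
  assume "m \<in> A_set 0 0 3 0"
  then have "\<not> m \<le> 4" using not_freely_prescribe_4 unfolding mem_A_set_three_neutral by blast
  then show "5 \<le> m" by simp
next
  assume "5 \<le> m"
  have "log 2 6 \<le> log 2 (2 ^ 5 :: real)" by simp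
  also have "\<dots> = real 5" by (rule log_pow_cancel) simp_all
  also have "\<dots> \<le> real m" using \<open>5 \<le> m\<close> by simp
  finally have "log 2 6 \<le> real m" .
  then show "m \<in> A_set 0 0 3 0"
    using \<open>5 \<le> m\<close> freely_prescribe_three unfolding mem_A_set_three_neutral by auto
qed

lemma no_three_paths:
  assumes "n \<in> {3, 4}"
  shows "\<exists>r g :: nat \<Rightarrow> vertex.
    (\<forall>i\<in>{1..3}. r i \<in> cube n \<and> red (r i)) \<and> inj_on r {1..3} \<and>
    (\<forall>i\<in>{1..3}. g i \<in> cube n \<and> green (g i)) \<and> inj_on g {1..3} \<and>
    \<not> (\<exists>\<gamma> :: nat \<Rightarrow> vertex list. k_path_covering 3 (hypercube n) (\<gamma> ` {1..3}) \<and>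
      (\<forall>i\<in>{1..3}. connects (\<gamma> i) (r i) (g i)))"
proof -
  have *: ?thesis
    if "\<forall>i\<in>{1..3}. r i \<in> cube n \<and> red (r i)" "inj_on r {1..3}"
      "\<forall>i\<in>{1..3}. g i \<in> cube n \<and> green (g i)" "inj_on g {1..3}"
      "\<And>P. path_covering (hypercube n) P \<Longrightarrow> ends ` P = (\<lambda>i. {r i, g i}) ` {1..3} \<Longrightarrow> False"
    for r g :: "nat \<Rightarrow> vertex"
  proof (intro exI conjI notI)
    assume "\<exists>\<gamma> :: nat \<Rightarrow> vertex list. k_path_covering 3 (hypercube n) (\<gamma> ` {1..3}) \<and>
      (\<forall>i\<in>{1..3}. connects (\<gamma> i) (r i) (g i))"
    then show False using that(5) ends_connecting unfolding k_path_covering_def by blast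
  qed (use that in blast)+
  show ?thesis
  proof (cases "n = 3")
    case True
    show ?thesis
    proof (rule *)
      show "\<forall>i\<in>{1..3}. corner i \<in> cube n \<and> red (corner i)" "inj_on corner {1..3}"
        "\<forall>i\<in>{1..3}. antipode i \<in> cube n \<and> green (antipode i)" "inj_on antipode {1..3}"
        using corner_antipode True by (auto simp: inj_on_def)
    qed (use no_covering_3 True in blast)
  next
    case False
    then have n: "n = 4" using assms by simp
    show ?thesis
    proof (rule *)
      show "\<forall>i\<in>{1..3}. False # corner i \<in> cube n \<and> red (False # corner i)"
        "inj_on (\<lambda>i. False # corner i) {1..3}"
        "\<forall>i\<in>{1..3}. False # antipode i \<in> cube n \<and> green (False # antipode i)"
        "inj_on (\<lambda>i. False # antipode i) {1..3}"
        using corner_antipode n by (auto simp: inj_on_def cube_def)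
    qed (use no_covering_4 n in blast)
  qed
qed

theorem lemma4p7:
  shows "(A_set 0 0 3 0 \<noteq> {} \<and> bracket 0 0 3 0 = 5) \<and>
    (\<forall>n\<ge>5. \<forall>r g :: nat \<Rightarrow> vertex.
       (\<forall>i\<in>{1..3}. r i \<in> verts (hypercube n) \<and> red (r i)) \<and> inj_on r {1..3} \<and>
       (\<forall>i\<in>{1..3}. g i \<in> verts (hypercube n) \<and> green (g i)) \<and> inj_on g {1..3} \<longrightarrow>
       (\<exists>\<gamma> :: nat \<Rightarrow> vertex list. k_path_covering 3 (hypercube n) (\<gamma> ` {1..3}) \<and>
            (\<forall>i\<in>{1..3}. connects (\<gamma> i) (r i) (g i)))) \<and>
    (\<forall>n\<in>{3, 4}. \<exists>r g :: nat \<Rightarrow> vertex.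
       (\<forall>i\<in>{1..3}. r i \<in> verts (hypercube n) \<and> red (r i)) \<and> inj_on r {1..3} \<and>
       (\<forall>i\<in>{1..3}. g i \<in> verts (hypercube n) \<and> green (g i)) \<and> inj_on g {1..3} \<and>
       \<not> (\<exists>\<gamma> :: nat \<Rightarrow> vertex list. k_path_covering 3 (hypercube n) (\<gamma> ` {1..3}) \<and>
            (\<forall>i\<in>{1..3}. connects (\<gamma> i) (r i) (g i))))"
proof (intro conjI ballI allI impI)
  show "A_set 0 0 3 0 \<noteq> {}" using A_set_three_neutral by blast
  show "bracket 0 0 3 0 = 5"
    unfolding bracket_def A_set_three_neutral by (rule Least_equality) auto
qed (unfold verts_hypercube, use three_paths_exist in blast, use no_three_paths in blast)

end
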